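(* Let $\varepsilon>0$ and let $F$ be an antiderivative of the function $x\mapsto(1+x^2)^{-1/4}$. Let $v_0,v_1\ge 0$. Then the geodesic restriction $\widehat{\mathsf{d}_S}$ of $\mathsf{d}_S$ to (one-dimensional centered) Gaussians can be expressed as $$\widehat{\mathsf{d}_S}(v_0,v_1)=\frac{\sqrt\varepsilon}{4}\left|F\left(\frac4\varepsilon v_1\right)-F\left(\frac4\varepsilon v_0\right)\right| .$$ The geodesic $(v_t)_{t\in[0,1]}$ joining $v_0$ to $v_1$ is given by $$v_t=\frac\varepsilon4F^{-1}\left[(1-t)F\left(\frac4\varepsilon v_0\right)+tF\left(\frac4\varepsilon v_1\right)\right]$$ and the map $t\mapsto v_t$ is convex.
   Context: The centered Gaussian $\mathcal{N}(0,v)$ on $\mathbb{R}$ (with quadratic cost $|x-y|^2$) is identified with its variance $v$ ($v=0$ being the Dirac mass at $0$). The Sinkhorn metric tensor restricted to these Gaussians is $\mathbf{g}_v(\dot v,\dot v)=g(v)\dot v^2$ with $g(v)=\frac{1}{4\sqrt{\varepsilon^2/16+v^2}}$. The geodesic restriction is the induced Riemannian path distance on variances: $$\widehat{\mathsf{d}_S}(v_0,v_1)=\left(\inf\int_0^1 g(v_t)\,\dot v_t^2\,dt\right)^{1/2},$$ the infimum over absolutely continuous paths $(v_t)_{t\in[0,1]}$ in $[0,\infty)$ from $v_0$ to $v_1$; "the geodesic" is the minimizing path. *)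

theory Defs
  imports "HOL-Analysis.Analysis"
begin

definition absolutely_continuous_fun_on :: "real set \<Rightarrow> (real \<Rightarrow> real) \<Rightarrow> bool" where
  "absolutely_continuous_fun_on I f \<longleftrightarrow>
     (\<forall>e>0. \<exists>d>0. \<forall>(n::nat) (a::nat \<Rightarrow> real) (b::nat \<Rightarrow> real).
        (\<forall>i<n. a i \<le> b i \<and> {a i..b i} \<subseteq> I) \<longrightarrow>
        disjoint_family_on (\<lambda>i. {a i<..<b i}) {..<n} \<longrightarrow>
        (\<Sum>i<n. b i - a i) < d \<longrightarrow>
        (\<Sum>i<n. \<bar>f (b i) - f (a i)\<bar>) < e)"

text \<open>The centered Gaussian of variance \<open>v\<close> is represented by \<open>v\<close> itself, with \<open>v = 0\<close> the
  Dirac mass at the origin.\<close>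

definition sinkhorn_g :: "real \<Rightarrow> real \<Rightarrow> real" where
  "sinkhorn_g \<epsilon> v = 1 / (4 * sqrt (\<epsilon>\<^sup>2 / 16 + v\<^sup>2))"

definition variance_paths :: "real \<Rightarrow> real \<Rightarrow> (real \<Rightarrow> real) set" where
  "variance_paths v\<^sub>0 v\<^sub>1 =
     {v. absolutely_continuous_fun_on {0..1} v \<and> (\<forall>t\<in>{0..1}. 0 \<le> v t) \<and> v 0 = v\<^sub>0 \<and> v 1 = v\<^sub>1}"

text \<open>An absolutely continuous path is differentiable almost everywhere, so the junk values of
  \<^const>\<open>deriv\<close> do not affect the integral; neither do the values of \<open>v\<close> outside the unit
  interval. The energy may be infinite.\<close>

definition path_energy :: "real \<Rightarrow> (real \<Rightarrow> real) \<Rightarrow> ennreal" where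
  "path_energy \<epsilon> v =
     (\<integral>\<^sup>+ t \<in> {0..1}. ennreal (sinkhorn_g \<epsilon> (v t) * (deriv v t)\<^sup>2) \<partial>lebesgue)"

definition ennreal_sqrt :: "ennreal \<Rightarrow> ennreal" where
  "ennreal_sqrt x = (if x = \<infinity> then \<infinity> else ennreal (sqrt (enn2real x)))"

definition sinkhorn_geodesic_dist :: "real \<Rightarrow> real \<Rightarrow> real \<Rightarrow> ennreal" where
  "sinkhorn_geodesic_dist \<epsilon> v\<^sub>0 v\<^sub>1 =
     ennreal_sqrt (INF v \<in> variance_paths v\<^sub>0 v\<^sub>1. path_energy \<epsilon> v)"

definition is_sinkhorn_geodesic :: "real \<Rightarrow> real \<Rightarrow> real \<Rightarrow> (real \<Rightarrow> real) \<Rightarrow> bool" where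
  "is_sinkhorn_geodesic \<epsilon> v\<^sub>0 v\<^sub>1 v \<longleftrightarrow>
     v \<in> variance_paths v\<^sub>0 v\<^sub>1 \<and> (\<forall>w \<in> variance_paths v\<^sub>0 v\<^sub>1. path_energy \<epsilon> v \<le> path_energy \<epsilon> w)"

end

theory Submission
  imports Defs
begin


text \<open>Put \<open>u = F (4 v / \<epsilon>)\<close>. Since \<open>F'\<^sup>2\<close> is the metric coefficient up to scaling, the energy of a
  path \<open>v\<close> is \<open>\<epsilon> / 16\<close> times the integral of \<open>u'\<^sup>2\<close>, whose minimum for prescribed endpoints is attained
  exactly when \<open>u\<close> is affine. As \<open>F\<close> is Lipschitz, \<open>u\<close> is absolutely continuous, and the argument only
  needs that \<open>u\<close> is the integral of its almost everywhere defined derivative. The geodesic is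
  convex because \<open>v'\<close> is the constant \<open>u'\<close> times a positive increasing function of \<open>v\<close>.

  Almost everywhere differentiability follows from a Vitali covering argument: at a
  point with two different derivates, tilting the function makes slopes of both signs
  occur at arbitrarily small scales, which forces variation in excess of that of a nearly optimal
  partition.\<close>

subsection \<open>Functions of bounded variation are differentiable almost everywhere\<close>

text \<open>The obstacle is that competing paths are merely absolutely continuous, while the energy
  sees only \<open>deriv\<close>, whose value is arbitrary where the path has no derivative. So such
  a path must be shown differentiable off a null set, which goes through bounded variation, and the
  increment of u over every interval {0..t} must be recovered by integrating u' taken off that set.
  The constants come from F'(x)^2 = 1 / sqrt (1 + x^2): at x = 4 v / \<epsilon> this equals
  \<epsilon> g(v), hence u'^2 = (16 / \<epsilon>) g(v) v'^2, and the square root of \<epsilon> / 16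
  is the factor in the distance. For t in the unit interval \<open>inv F\<close> is applied to a
  value between F (4 \<open>v\<^sub>0\<close> / \<epsilon>) and F (4 \<open>v\<^sub>1\<close> /
  \<epsilon>), where the intermediate value theorem supplies a preimage. The minimizer therefore
  stays between its end variances and satisfies the constraint v \<ge> 0. That constraint is also
  what convexity rests on: (1 + x^2) powr (1/4) is increasing only for x \<ge> 0.\<close>

lemma mono_on_sum_increments_le:
  fixes N :: "real \<Rightarrow> real"
  assumes "finite I" and "mono_on {s..t} N" and "s \<le> t"
    and "\<And>i. i \<in> I \<Longrightarrow> s \<le> u i \<and> u i \<le> v i \<and> v i \<le> t"
    and "pairwise (\<lambda>i j. disjnt {u i..v i} {u j..v j}) I"
  shows "(\<Sum>i\<in>I. N (v i) - N (u i)) \<le> N t - N s"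
  using assms
\<comment> \<open>The interval inserted last has the largest left endpoint, so by disjointness all
  others end at or before \<open>u i\<close>, and the induction hypothesis applies with
  \<open>u i\<close> in place of \<open>t\<close>.\<close>
proof (induction I arbitrary: t rule: finite_ranking_induct[where f = u])
  case empty
  then show ?case by (auto simp: mono_on_def)
next
  case (insert i I)
  have i: "s \<le> u i" "u i \<le> v i" "v i \<le> t" using insert.prems(3)[of i] by auto
  have mono: "mono_on {s..u i} N"
    using insert.prems(1) i by (auto simp: mono_on_def)
  have v: "v j \<le> u i" if "j \<in> I" "j \<noteq> i" for j
  proof -
    have "disjnt {u i..v i} {u j..v j}"
      using insert.prems(4) that by (auto simp: pairwise_def)
    then have "u i \<notin> {u j..v j}" using i by (auto simp: disjnt_def)
    then show ?thesis using insert.hyps(2)[OF that(1)] by auto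
  qed
  show ?case
  proof (cases "i \<in> I")
    case True
    then show ?thesis using insert.IH[of t] insert.prems by (simp add: insert_absorb)
  next
    case False
    have "(\<Sum>j\<in>I. N (v j) - N (u j)) \<le> N (u i) - N s"
      using insert.prems False i(1) v
      by (intro insert.IH mono) (auto simp: pairwise_insert)
    moreover have "N (v i) \<le> N t"
      using insert.prems(1,2) i by (auto simp: mono_on_def)
    ultimately show ?thesis using False insert.hyps(1) by simp
  qed
qed

text \<open>Vitali: among the steep intervals choose disjoint ones whose fivefold enlargements still
  cover \<open>S\<close>. Each has length at most its increment of \<open>N\<close> divided by
  \<open>c\<close>, and increments over disjoint intervals add up to at most
  \<open>N t - N s\<close>. The factor 5 is that of the enlargement.\<close>

lemma mono_on_steep_points_cover:
  fixes N :: "real \<Rightarrow> real"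
  assumes mono: "mono_on {s..t} N" and st: "s \<le> t" and c: "c > 0"
    and steep: "\<And>x. x \<in> S \<Longrightarrow> \<exists>u v. s \<le> u \<and> u \<le> x \<and> x \<le> v \<and> v \<le> t \<and> u < v \<and> c * (v - u) \<le> N v - N u"
  obtains B where "B \<in> lmeasurable" "S \<subseteq> B" "measure lebesgue B \<le> 5 * (N t - N s) / c"
proof -
  define K where "K = {(u, v). s \<le> u \<and> v \<le> t \<and> u < v \<and> c * (v - u) \<le> N v - N u}"
  let ?a = "\<lambda>p. (fst p + snd p) / 2 :: real" and ?r = "\<lambda>p. (snd p - fst p) / 2 :: real"
  have cb: "cball (?a p) (?r p) = {fst p..snd p}" for p
    by (simp add: cball_eq_atLeastAtMost field_simps)
  have "S \<subseteq> (\<Union>p\<in>K. cball (?a p) (?r p))"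
  proof
    fix x assume "x \<in> S"
    from steep[OF this] obtain u v where uv: "(u, v) \<in> K" "x \<in> {u..v}" by (auto simp: K_def)
    show "x \<in> (\<Union>p\<in>K. cball (?a p) (?r p))"
      by (rule UN_I[OF uv(1)], subst cb) (use uv(2) in simp)
  qed
  moreover have "0 < ?r p \<and> ?r p \<le> (t - s) / 2" if "p \<in> K" for p
    using that by (auto simp: K_def)
  ultimately obtain C where C: "countable C" "C \<subseteq> K"
      "pairwise (\<lambda>i j. disjnt (cball (?a i) (?r i)) (cball (?a j) (?r j))) C"
      "S \<subseteq> (\<Union>i\<in>C. cball (?a i) (5 * ?r i))"
    by (rule Vitali_covering_lemma_cballs[where S = S and a = ?a and r = ?r and K = K]) blast
  \<comment> \<open>A bound uniform over finite subfamilies passes to the countable union and shows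
    at the same time that the union has finite measure.\<close>
  have bound: "measure lebesgue (\<Union>i\<in>I. cball (?a i) (5 * ?r i)) \<le> 5 * (N t - N s) / c"
    if I: "I \<subseteq> C" "finite I" for I
  proof -
    have K: "i \<in> K" if "i \<in> I" for i using that I C by auto
    have "measure lebesgue (\<Union>i\<in>I. cball (?a i) (5 * ?r i)) \<le>
        (\<Sum>i\<in>I. measure lebesgue (cball (?a i) (5 * ?r i)))"
      by (intro measure_UNION_le I) auto
    also have "\<dots> \<le> (\<Sum>i\<in>I. 5 / c * (N (snd i) - N (fst i)))"
    proof (rule sum_mono)
      fix i assume "i \<in> I"
      from K[OF this] have i: "fst i < snd i" "c * (snd i - fst i) \<le> N (snd i) - N (fst i)"
        by (auto simp: K_def)
      have "measure lebesgue (cball (?a i) (5 * ?r i)) = 5 * (snd i - fst i)"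
        using i by (simp add: cball_eq_atLeastAtMost max_def field_simps)
      also have "\<dots> \<le> 5 / c * (N (snd i) - N (fst i))"
        using i c by (simp add: field_simps)
      finally show "measure lebesgue (cball (?a i) (5 * ?r i)) \<le> 5 / c * (N (snd i) - N (fst i))" .
    qed
    also have "\<dots> = 5 / c * (\<Sum>i\<in>I. N (snd i) - N (fst i))"
      by (rule sum_distrib_left[symmetric])
    also have "\<dots> \<le> 5 / c * (N t - N s)"
    proof (rule mult_left_mono)
      show "(\<Sum>i\<in>I. N (snd i) - N (fst i)) \<le> N t - N s"
      proof (rule mono_on_sum_increments_le[OF I(2) mono st])
        show "s \<le> fst i \<and> fst i \<le> snd i \<and> snd i \<le> t" if "i \<in> I" for i
          using K[OF that] by (auto simp: K_def)
        show "pairwise (\<lambda>i j. disjnt {fst i..snd i} {fst j..snd j}) I"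
          using pairwise_subset[OF C(3) I(1)] unfolding cb .
      qed
    qed (use c in auto)
    finally show ?thesis by simp
  qed
  show ?thesis
  proof (rule that)
    show "(\<Union>i\<in>C. cball (?a i) (5 * ?r i)) \<in> lmeasurable"
      by (rule fmeasurable_UN_bound[OF C(1) _ bound]) auto
    show "measure lebesgue (\<Union>i\<in>C. cball (?a i) (5 * ?r i)) \<le> 5 * (N t - N s) / c"
      by (rule measure_UN_bound[OF C(1) _ bound]) auto
  qed (rule C(4))
qed

text \<open>Partitions are encoded as infinite monotone sequences of which \<open>n\<close> steps
  are summed. Repeated points are allowed, so cutting a sequence off with \<open>min\<close> or
  \<open>max\<close> again yields a partition.\<close>

definition bounded_variation_by :: "real \<Rightarrow> real \<Rightarrow> (real \<Rightarrow> real) \<Rightarrow> real \<Rightarrow> bool" where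
  "bounded_variation_by a b g M \<longleftrightarrow>
     (\<forall>n p. mono p \<longrightarrow> range p \<subseteq> {a..b} \<longrightarrow> (\<Sum>i<n. \<bar>g (p (Suc i)) - g (p i)\<bar>) \<le> M)"

text \<open>Steps of a monotone sequence are nonnegative and telescope, so a linear term costs at
  most its slope times the length. This is what permits tilting.\<close>

lemma bounded_variation_by_add_linear:
  assumes "bounded_variation_by a b f M" and "a \<le> b"
  shows "bounded_variation_by a b (\<lambda>x. f x + c * x) (M + \<bar>c\<bar> * (b - a))"
  unfolding bounded_variation_by_def
proof safe
  fix n :: nat and p :: "nat \<Rightarrow> real"
  assume p: "mono p" "range p \<subseteq> {a..b}"
  have "(\<Sum>i<n. \<bar>f (p (Suc i)) + c * p (Suc i) - (f (p i) + c * p i)\<bar>)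
      \<le> (\<Sum>i<n. \<bar>f (p (Suc i)) - f (p i)\<bar> + \<bar>c\<bar> * (p (Suc i) - p i))"
  proof (rule sum_mono)
    fix i
    have "p i \<le> p (Suc i)" using p(1) by (simp add: mono_def)
    then have "\<bar>c\<bar> * (p (Suc i) - p i) = \<bar>c * (p (Suc i) - p i)\<bar>" by (simp add: abs_mult)
    then show "\<bar>f (p (Suc i)) + c * p (Suc i) - (f (p i) + c * p i)\<bar>
      \<le> \<bar>f (p (Suc i)) - f (p i)\<bar> + \<bar>c\<bar> * (p (Suc i) - p i)"
      by (simp add: right_diff_distrib)
  qed
  also have "\<dots> = (\<Sum>i<n. \<bar>f (p (Suc i)) - f (p i)\<bar>) + \<bar>c\<bar> * (p n - p 0)"
    by (simp add: sum.distrib flip: sum_distrib_left sum_lessThan_telescope)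
  also have "\<dots> \<le> M + \<bar>c\<bar> * (b - a)"
  proof (intro add_mono mult_left_mono)
    show "(\<Sum>i<n. \<bar>f (p (Suc i)) - f (p i)\<bar>) \<le> M"
      using assms p by (auto simp: bounded_variation_by_def)
    have "p n \<in> {a..b}" "p 0 \<in> {a..b}" using p(2) by blast+
    then show "p n - p 0 \<le> b - a" by simp
  qed auto
  finally show "(\<Sum>i<n. \<bar>f (p (Suc i)) + c * p (Suc i) - (f (p i) + c * p i)\<bar>) \<le> M + \<bar>c\<bar> * (b - a)" .
qed

section \<open>Total variation as a function of the right endpoint\<close>

definition variation_fun :: "real \<Rightarrow> (real \<Rightarrow> real) \<Rightarrow> real \<Rightarrow> real" where
  "variation_fun a g x =
     (SUP (n, p) \<in> {(n, p). mono p \<and> p 0 = a \<and> p n = x}. \<Sum>i<n. \<bar>g (p (Suc i)) - g (p i)\<bar>)"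

context
  fixes a b M :: real and g :: "real \<Rightarrow> real"
  assumes ab: "a \<le> b" and bv: "bounded_variation_by a b g M"
begin

lemma variation_sum_le:
  assumes "mono p" "p 0 = a" "p n = x" "x \<le> b"
  shows "(\<Sum>i<n. \<bar>g (p (Suc i)) - g (p i)\<bar>) \<le> M"
proof -
  \<comment> \<open>After index \<open>n\<close> the sequence \<open>p\<close> may leave {a..b};
    freezing it there restores the range condition and leaves the summed steps unchanged.\<close>
  define q where "q i = p (min i n)" for i :: nat
  have "mono q" using assms(1) by (auto simp: q_def mono_def)
  moreover have "range q \<subseteq> {a..b}"
  proof safe
    fix i
    have "p 0 \<le> q i" "q i \<le> p n" using assms(1) by (auto simp: q_def mono_def)
    then show "q i \<in> {a..b}" using assms by auto
  qed
  ultimately have "(\<Sum>i<n. \<bar>g (q (Suc i)) - g (q i)\<bar>) \<le> M"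
    using bv by (auto simp: bounded_variation_by_def)
  moreover have "(\<Sum>i<n. \<bar>g (q (Suc i)) - g (q i)\<bar>) = (\<Sum>i<n. \<bar>g (p (Suc i)) - g (p i)\<bar>)"
    by (rule sum.cong) (auto simp: q_def min_def)
  ultimately show ?thesis by simp
qed

lemma variation_fun_upper:
  assumes "mono p" "p 0 = a" "p n = x" "x \<le> b"
  shows "(\<Sum>i<n. \<bar>g (p (Suc i)) - g (p i)\<bar>) \<le> variation_fun a g x"
proof -
  have "bdd_above ((\<lambda>(n, p). \<Sum>i<n. \<bar>g (p (Suc i)) - g (p i)\<bar>) ` {(n, p). mono p \<and> p 0 = a \<and> p n = x})"
    by (rule bdd_aboveI2[where M = M]) (use assms(4) in \<open>clarsimp simp: variation_sum_le\<close>)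
  from cSUP_upper[OF _ this, of "(n, p)"] show ?thesis
    using assms by (simp add: variation_fun_def)
qed

lemma variation_fun_nonempty:
  assumes "a \<le> x"
  obtains p and n :: nat where "mono p" "p 0 = a" "p n = x"
proof -
  have "mono (\<lambda>i::nat. if i = 0 then a else x)" using assms by (simp add: mono_def)
  from that[OF this, of 1] show ?thesis by simp
qed

lemma variation_fun_le:
  assumes "a \<le> x" "\<And>p n. mono p \<Longrightarrow> p 0 = a \<Longrightarrow> p n = x \<Longrightarrow> (\<Sum>i<n. \<bar>g (p (Suc i)) - g (p i)\<bar>) \<le> B"
  shows "variation_fun a g x \<le> B"
  unfolding variation_fun_def
proof (rule cSUP_least)
  obtain p and n :: nat where "mono p" "p 0 = a" "p n = x"
    by (rule variation_fun_nonempty[OF assms(1)])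
  then have "(n, p) \<in> {(n, p). mono p \<and> p 0 = a \<and> p n = x}" by simp
  then show "{(n, p :: nat \<Rightarrow> real). mono p \<and> p 0 = a \<and> p n = x} \<noteq> {}"
    by (metis empty_iff)
next
  fix z :: "nat \<times> (nat \<Rightarrow> real)" assume "z \<in> {(n, p). mono p \<and> p 0 = a \<and> p n = x}"
  then show "(case z of (n, p) \<Rightarrow> \<Sum>i<n. \<bar>g (p (Suc i)) - g (p i)\<bar>) \<le> B"
    using assms(2) by (cases z) simp
qed

text \<open>Appending \<open>y\<close> to a partition of [a, x] adds exactly one term. As a
  consequence the variation function stays nondecreasing after adding or subtracting
  \<open>g\<close>.\<close>

lemma variation_fun_increment:
  assumes "a \<le> x" "x \<le> y" "y \<le> b"
  shows "variation_fun a g x + \<bar>g y - g x\<bar> \<le> variation_fun a g y"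
proof -
  have "variation_fun a g x \<le> variation_fun a g y - \<bar>g y - g x\<bar>"
  proof (rule variation_fun_le[OF assms(1)])
    fix p and n :: nat assume p: "mono p" "p 0 = a" "p n = x"
    define q where "q i = (if i \<le> n then p i else y)" for i :: nat
    have "p i \<le> y" if "i \<le> n" for i using p monoD[OF p(1) that] assms by auto
    then have "mono q" using p(1) by (auto simp: q_def mono_def)
    then have "(\<Sum>i<Suc n. \<bar>g (q (Suc i)) - g (q i)\<bar>) \<le> variation_fun a g y"
      by (rule variation_fun_upper) (use p assms in \<open>auto simp: q_def\<close>)
    moreover have "(\<Sum>i<n. \<bar>g (q (Suc i)) - g (q i)\<bar>) = (\<Sum>i<n. \<bar>g (p (Suc i)) - g (p i)\<bar>)"
      by (rule sum.cong) (auto simp: q_def)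
    ultimately show "(\<Sum>i<n. \<bar>g (p (Suc i)) - g (p i)\<bar>) \<le> variation_fun a g y - \<bar>g y - g x\<bar>"
      using p by (simp add: q_def)
  qed
  then show ?thesis by simp
qed

lemma variation_fun_nonneg:
  assumes "a \<le> x" "x \<le> b"
  shows "0 \<le> variation_fun a g x"
proof -
  obtain p n where "mono p" "p 0 = a" "p (n::nat) = x" using variation_fun_nonempty[OF assms(1)] by metis
  from variation_fun_upper[OF this assms(2)] show ?thesis
    by (rule order_trans[rotated]) (simp add: sum_nonneg)
qed

lemma variation_fun_approx:
  assumes "e > 0"
  obtains p n where "mono p" "p 0 = a" "p n = b"
    "variation_fun a g b - e < (\<Sum>i<n. \<bar>g (p (Suc i)) - g (p i)\<bar>)"
proof -
  have "\<exists>p n. mono p \<and> p 0 = a \<and> p n = b \<and> variation_fun a g b - e < (\<Sum>i<n. \<bar>g (p (Suc i)) - g (p i)\<bar>)"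
  proof (rule ccontr)
    assume "\<not> ?thesis"
    then have "variation_fun a g b \<le> variation_fun a g b - e"
      by (intro variation_fun_le[OF ab]) (metis not_less)
    then show False using assms by simp
  qed
  then show ?thesis using that by blast
qed

text \<open>On each interval of a nearly optimal partition the variation minus the absolute increment
  is small, and it is the total increment of \<open>T - g\<close> or \<open>T + g\<close>, one of which is steep near the
  points in question.\<close>

lemma bounded_variation_conflicting_slopes_negligible:
  assumes d: "d > 0"
  shows "negligible {x \<in> {a<..<b}. \<forall>\<delta>>0.
     (\<exists>u v. u \<le> x \<and> x \<le> v \<and> u < v \<and> v - u < \<delta> \<and> d * (v - u) \<le> g v - g u) \<and>
     (\<exists>u v. u \<le> x \<and> x \<le> v \<and> u < v \<and> v - u < \<delta> \<and> d * (v - u) \<le> g u - g v)}"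
    (is "negligible ?E")
  unfolding negligible_outer_le
proof safe
  fix e :: real assume e: "e > 0"
  let ?T = "variation_fun a g"
  \<comment> \<open>With total excess below \<eta>, the covering lemma at slope \<open>d\<close>
    yields measure at most 5 \<eta> / d = e.\<close>
  define \<eta> where "\<eta> = e * d / 5"
  have "\<eta> > 0" using e d by (simp add: \<eta>_def)
  then obtain p n where p: "mono p" "p 0 = a" "p n = b"
    "?T b - \<eta> < (\<Sum>i<n. \<bar>g (p (Suc i)) - g (p i)\<bar>)" by (rule variation_fun_approx)
  have pin: "a \<le> p i" "p i \<le> b" if "i \<le> n" for i
    using that p monoD[OF p(1)] by auto
  have "\<exists>B. B \<in> lmeasurable \<and> ?E \<inter> {p i<..<p (Suc i)} \<subseteq> B \<and>
     measure lebesgue B \<le> 5 * (?T (p (Suc i)) - ?T (p i) - \<bar>g (p (Suc i)) - g (p i)\<bar>) / d"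
    if i: "i < n" for i
  proof -
    let ?s = "p i" and ?t = "p (Suc i)"
    \<comment> \<open>\<sigma> is the sign of the increment of \<open>g\<close> over this cell.
      Movement of \<open>g\<close> against \<sigma> is wasted variation: it makes \<open>?N\<close>
      steep, although the total increment of \<open>?N\<close> over the cell is only the excess of
      variation.\<close>
    define \<sigma> :: real where "\<sigma> = (if g ?s \<le> g ?t then 1 else -1)"
    let ?N = "\<lambda>x. ?T x - \<sigma> * g x"
    have inc: "?N x + (\<bar>g y - g x\<bar> - \<sigma> * (g y - g x)) \<le> ?N y"
      if "?s \<le> x" "x \<le> y" "y \<le> ?t" for x y
      using variation_fun_increment[of x y] that pin[of i] pin[of "Suc i"] i by (simp add: algebra_simps)
    have "mono_on {?s..?t} ?N"
    proof (rule mono_onI)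
      fix x y assume "x \<in> {?s..?t}" "y \<in> {?s..?t}" "x \<le> y"
      then have "?N x + (\<bar>g y - g x\<bar> - \<sigma> * (g y - g x)) \<le> ?N y" by (intro inc) auto
      moreover have "\<sigma> * (g y - g x) \<le> \<bar>g y - g x\<bar>" by (auto simp: \<sigma>_def)
      ultimately show "?N x \<le> ?N y" by simp
    qed
    moreover have "?s \<le> ?t" using p(1) by (simp add: mono_def)
    moreover note d
    moreover have "\<exists>u v. ?s \<le> u \<and> u \<le> x \<and> x \<le> v \<and> v \<le> ?t \<and> u < v \<and> d * (v - u) \<le> ?N v - ?N u"
      if x: "x \<in> ?E \<inter> {?s<..<?t}" for x
    proof -
      \<comment> \<open>Intervals around \<open>x\<close> shorter than this stay inside the
        cell.\<close>
      define \<delta> where "\<delta> = min (x - ?s) (?t - x)"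
      have "\<delta> > 0" using x by (auto simp: \<delta>_def)
      with x have *: "(\<exists>u v. u \<le> x \<and> x \<le> v \<and> u < v \<and> v - u < \<delta> \<and> d * (v - u) \<le> g v - g u)"
        "(\<exists>u v. u \<le> x \<and> x \<le> v \<and> u < v \<and> v - u < \<delta> \<and> d * (v - u) \<le> g u - g v)" by blast+
      have "\<exists>u v. u \<le> x \<and> x \<le> v \<and> u < v \<and> v - u < \<delta> \<and> d * (v - u) \<le> - \<sigma> * (g v - g u)"
        using * by (cases "g ?s \<le> g ?t") (simp_all add: \<sigma>_def)
      then obtain u v where uv: "u \<le> x" "x \<le> v" "u < v" "v - u < \<delta>" "d * (v - u) \<le> - \<sigma> * (g v - g u)"
        by blast
      have st: "?s \<le> u" "v \<le> ?t" using uv by (auto simp: \<delta>_def)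
      have "d * (v - u) \<le> ?N v - ?N u" using inc[of u v] st uv by simp
      then show ?thesis using uv st by blast
    qed
    ultimately obtain B where "B \<in> lmeasurable" "?E \<inter> {?s<..<?t} \<subseteq> B"
      "measure lebesgue B \<le> 5 * (?N ?t - ?N ?s) / d" by (rule mono_on_steep_points_cover)
    moreover have "?N ?t - ?N ?s = ?T ?t - ?T ?s - \<bar>g ?t - g ?s\<bar>"
      by (auto simp: \<sigma>_def)
    ultimately show ?thesis by (intro exI[of _ B]) simp
  qed
  then have "\<forall>i\<in>{..<n}. \<exists>B. B \<in> lmeasurable \<and> ?E \<inter> {p i<..<p (Suc i)} \<subseteq> B \<and>
     measure lebesgue B \<le> 5 * (?T (p (Suc i)) - ?T (p i) - \<bar>g (p (Suc i)) - g (p i)\<bar>) / d"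
    by simp
  from bchoice[OF this] obtain B where *: "\<forall>i\<in>{..<n}. B i \<in> lmeasurable \<and> ?E \<inter> {p i<..<p (Suc i)} \<subseteq> B i \<and>
     measure lebesgue (B i) \<le> 5 * (?T (p (Suc i)) - ?T (p i) - \<bar>g (p (Suc i)) - g (p i)\<bar>) / d"
    by (rule exE)
  have B: "B i \<in> lmeasurable" "?E \<inter> {p i<..<p (Suc i)} \<subseteq> B i"
    "measure lebesgue (B i) \<le> 5 * (?T (p (Suc i)) - ?T (p i) - \<bar>g (p (Suc i)) - g (p i)\<bar>) / d"
    if "i < n" for i
    using *[rule_format, of i] that by simp_all
  \<comment> \<open>The partition points belong to no open cell and are added as a finite null
    set.\<close>
  let ?U = "p ` {..n} \<union> (\<Union>i<n. B i)"
  have neg: "negligible (p ` {..n})" by (intro negligible_finite) auto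
  have Bm: "(\<Union>i<n. B i) \<in> lmeasurable" using B(1) by (intro fmeasurable.finite_UN) auto
  show "\<exists>U. ?E \<subseteq> U \<and> U \<in> lmeasurable \<and> measure lebesgue U \<le> e"
  proof (intro exI conjI)
    show "?E \<subseteq> ?U"
    proof
      fix x assume x: "x \<in> ?E"
      show "x \<in> ?U"
      proof (cases "x \<in> p ` {..n}")
        case False
        define i where "i = (GREATEST i. i \<le> n \<and> p i < x)"
        have ex: "0 \<le> n \<and> p 0 < x" using x p by auto
        have i: "i \<le> n" "p i < x"
          using GreatestI_nat[where P = "\<lambda>i. i \<le> n \<and> p i < x" and b = n, OF ex] by (auto simp: i_def)
        have "i \<noteq> n" using i p x by auto
        then have "i < n" using i by simp
        have "\<not> p (Suc i) < x"
          using Greatest_le_nat[where P = "\<lambda>i. i \<le> n \<and> p i < x" and b = n and k = "Suc i"] \<open>i < n\<close>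
          by (auto simp: i_def[symmetric])
        moreover have "p (Suc i) \<noteq> x" using False \<open>i < n\<close> by auto
        ultimately show ?thesis using B(2)[OF \<open>i < n\<close>] x i \<open>i < n\<close> by auto
      qed auto
    qed
    show "?U \<in> lmeasurable"
      by (rule fmeasurable.Un[OF negligible_imp_measurable[OF neg] Bm])
    have "measure lebesgue ?U \<le> measure lebesgue (p ` {..n}) + measure lebesgue (\<Union>i<n. B i)"
      by (rule measure_Un_le[OF fmeasurableD[OF negligible_imp_measurable[OF neg]] fmeasurableD[OF Bm]])
    also have "measure lebesgue (p ` {..n}) = 0" using neg by (rule negligible_imp_measure0)
    also have "measure lebesgue (\<Union>i<n. B i) \<le> (\<Sum>i<n. measure lebesgue (B i))"
      using B(1) by (intro measure_UNION_le) auto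
    also have "\<dots> \<le> (\<Sum>i<n. 5 * (?T (p (Suc i)) - ?T (p i) - \<bar>g (p (Suc i)) - g (p i)\<bar>) / d)"
      using B(3) by (intro sum_mono) auto
    also have "\<dots> = 5 * (\<Sum>i<n. ?T (p (Suc i)) - ?T (p i) - \<bar>g (p (Suc i)) - g (p i)\<bar>) / d"
      by (simp add: sum_distrib_left sum_divide_distrib)
    also have "(\<Sum>i<n. ?T (p (Suc i)) - ?T (p i) - \<bar>g (p (Suc i)) - g (p i)\<bar>)
       = (?T b - ?T a) - (\<Sum>i<n. \<bar>g (p (Suc i)) - g (p i)\<bar>)"
      using p sum_lessThan_telescope[of "\<lambda>i. ?T (p i)" n] by (simp add: sum_subtractf)
    \<comment> \<open>Near-optimality of \<open>p\<close> bounds \<open>?T b\<close> minus the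
      partition sum by \<eta>, and subtracting \<open>?T a\<close> \<ge> 0 only helps.\<close>
    also have "0 + 5 * \<dots> / d \<le> 5 * \<eta> / d"
      using p(4) variation_fun_nonneg[OF order_refl ab] d
      by (simp add: divide_right_mono)
    also have "\<dots> = e" using d by (simp add: \<eta>_def)
    finally show "measure lebesgue ?U \<le> e" by simp
  qed
qed

text \<open>At such points the variation function is steeper than every \<open>c\<close> on small
  intervals, so the covering lemma bounds the set by a measure of order 1 / c.\<close>

lemma bounded_variation_infinite_slopes_negligible:
  "negligible {x \<in> {a<..<b}. \<forall>c>0. \<forall>\<delta>>0.
     \<exists>u v. u \<le> x \<and> x \<le> v \<and> u < v \<and> v - u < \<delta> \<and> c * (v - u) \<le> \<bar>g v - g u\<bar>}"
    (is "negligible ?E")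
  unfolding negligible_outer_le
proof safe
  fix e :: real assume e: "e > 0"
  let ?T = "variation_fun a g"
  \<comment> \<open>The summand 1 keeps \<open>c\<close> positive when the variation
    vanishes.\<close>
  define c where "c = 5 * (?T b - ?T a + 1) / e"
  have T: "?T x + \<bar>g y - g x\<bar> \<le> ?T y" if "x \<in> {a..b}" "y \<in> {a..b}" "x \<le> y" for x y
    using variation_fun_increment[of x y] that by auto
  then have "mono_on {a..b} ?T"
    by (force intro: mono_onI)
  moreover have Tab: "?T a \<le> ?T b" using T[of a b] ab by auto
  then have "c > 0" using e by (auto simp: c_def intro!: divide_pos_pos)
  moreover have "\<exists>u v. a \<le> u \<and> u \<le> x \<and> x \<le> v \<and> v \<le> b \<and> u < v \<and> c * (v - u) \<le> ?T v - ?T u"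
    if x: "x \<in> ?E" for x
  proof -
    have "min (x - a) (b - x) > 0" using x by auto
    with x \<open>c > 0\<close> obtain u v where uv: "u \<le> x" "x \<le> v" "u < v" "v - u < min (x - a) (b - x)"
      "c * (v - u) \<le> \<bar>g v - g u\<bar>" by blast
    moreover from uv have "a \<le> u" "v \<le> b" by auto
    ultimately show ?thesis using T[of u v] by (intro exI[of _ u] exI[of _ v]) auto
  qed
  ultimately obtain B where B: "B \<in> lmeasurable" "?E \<subseteq> B" "measure lebesgue B \<le> 5 * (?T b - ?T a) / c"
    using ab by (rule_tac mono_on_steep_points_cover[where S = ?E])
  have "5 * (?T b - ?T a) / c \<le> e"
    using \<open>c > 0\<close> e Tab by (simp add: c_def field_simps)
  then have "measure lebesgue B \<le> e" using B(3) by simp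
  with B(1,2) show "\<exists>B. ?E \<subseteq> B \<and> B \<in> lmeasurable \<and> measure lebesgue B \<le> e"
    by (intro exI[of _ B] conjI)
qed

end


text \<open>Intervals that contain \<open>x\<close>, possibly as an endpoint, include the one-sided
  cases u = x and v = x, so one condition controls difference quotients from both sides.\<close>

lemma eventually_difference_quotientI:
  fixes f :: "real \<Rightarrow> real"
  assumes "\<delta> > 0"
    and P: "\<And>u v. u \<le> x \<Longrightarrow> x \<le> v \<Longrightarrow> u < v \<Longrightarrow> v - u < \<delta> \<Longrightarrow> P ((f v - f u) / (v - u))"
  shows "eventually (\<lambda>y. P ((f y - f x) / (y - x))) (at x)"
  unfolding eventually_at
proof (intro exI[of _ \<delta>] conjI ballI impI)
  fix y assume y: "y \<noteq> x \<and> dist y x < \<delta>"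
  show "P ((f y - f x) / (y - x))"
  proof (cases "x < y")
    case True
    then show ?thesis using P[of x y] y by (simp add: dist_real_def)
  next
    case False
    have "(f x - f y) / (x - y) = (f y - f x) / (y - x)"
      by (metis minus_diff_eq minus_divide_divide)
    then show ?thesis using P[of y x] y False by (simp add: dist_real_def)
  qed
qed fact

text \<open>If the lower limit were below the upper one, two rationals would fit strictly between
  them and contradict \<open>gap\<close>; boundedness makes the common value finite. Using rationals
  keeps the exceptional sets countable in number.\<close>

lemma tendsto_real_of_bounded:
  fixes s :: "'a \<Rightarrow> real"
  assumes F: "F \<noteq> bot"
    and bounded: "eventually (\<lambda>y. \<bar>s y\<bar> \<le> c) F"
    and gap: "\<And>r q. r \<in> \<rat> \<Longrightarrow> q \<in> \<rat> \<Longrightarrow> r < q \<Longrightarrow> eventually (\<lambda>y. s y \<le> q) F \<or> eventually (\<lambda>y. r \<le> s y) F"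
  obtains l where "(s \<longlongrightarrow> l) F"
proof -
  let ?L = "Liminf F (\<lambda>y. ereal (s y))" and ?U = "Limsup F (\<lambda>y. ereal (s y))"
  have "?U \<le> ?L"
  proof (rule ccontr)
    assume "\<not> ?U \<le> ?L"
    then have "?L < ?U" by (simp only: not_le)
    from ereal_dense3[OF this] obtain r where r: "?L < real_of_rat r" "real_of_rat r < ?U"
      by (elim exE conjE)
    from ereal_dense3[OF r(2)] obtain q where q: "real_of_rat r < real_of_rat q" "real_of_rat q < ?U"
      by auto
    from gap[OF _ _ q(1)] consider "eventually (\<lambda>y. ereal (s y) \<le> real_of_rat q) F"
      | "eventually (\<lambda>y. real_of_rat r \<le> ereal (s y)) F" by auto
    then show False
    proof cases
      case 1
      from Limsup_bounded[OF this] q(2) show False by simp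
    next
      case 2
      from Liminf_bounded[OF this] r(1) show False by simp
    qed
  qed
  then have eq: "?L = ?U" by (intro antisym Liminf_le_Limsup F)
  have "eventually (\<lambda>y. ereal (s y) \<le> c) F" "eventually (\<lambda>y. ereal (- c) \<le> s y) F"
    using bounded by (auto elim!: eventually_mono)
  then have "?U \<le> c" "ereal (- c) \<le> ?L" by (simp_all add: Limsup_bounded Liminf_bounded)
  then obtain l where l: "?U = ereal l" using eq by (cases ?U) auto
  have "((\<lambda>y. ereal (s y)) \<longlongrightarrow> ereal l) F"
    using F eq l by (intro Liminf_eq_Limsup) auto
  then show ?thesis by (intro that) simp
qed

text \<open>Where differentiability fails, either the quotients are unbounded (the set
  \<open>I\<close>) or they keep crossing some rational gap (a set \<open>E r q\<close>). These are
  countably many null sets.\<close>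

theorem bounded_variation_differentiable_ae:
  fixes f :: "real \<Rightarrow> real"
  assumes ab: "a \<le> b" and bv: "bounded_variation_by a b f M"
  shows "negligible {x \<in> {a<..<b}. \<not> f field_differentiable (at x)}"
proof -
  define E where "E r q = {x \<in> {a<..<b}. \<forall>\<delta>>0.
     (\<exists>u v. u \<le> x \<and> x \<le> v \<and> u < v \<and> v - u < \<delta> \<and> q * (v - u) \<le> f v - f u) \<and>
     (\<exists>u v. u \<le> x \<and> x \<le> v \<and> u < v \<and> v - u < \<delta> \<and> f v - f u \<le> r * (v - u))}" for r q :: real
  define I where "I = {x \<in> {a<..<b}. \<forall>c>0. \<forall>\<delta>>0.
     \<exists>u v. u \<le> x \<and> x \<le> v \<and> u < v \<and> v - u < \<delta> \<and> c * (v - u) \<le> \<bar>f v - f u\<bar>}"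
  have negE: "negligible (E r q)" if "r < q" for r q
  proof -
    \<comment> \<open>Tilting by the mean of \<open>r\<close> and \<open>q\<close> turns slopes at
      least \<open>q\<close> and at most \<open>r\<close> into slopes at least d and at most -d,
      where d = (q - r) / 2.\<close>
    let ?g = "\<lambda>x. f x + (- ((r + q) / 2)) * x"
    have "(q - r) / 2 * (v - u) \<le> ?g v - ?g u \<longleftrightarrow> q * (v - u) \<le> f v - f u"
      "(q - r) / 2 * (v - u) \<le> ?g u - ?g v \<longleftrightarrow> f v - f u \<le> r * (v - u)" for u v
      by (auto simp: field_simps)
    then show ?thesis
      using bounded_variation_conflicting_slopes_negligible[OF ab bounded_variation_by_add_linear[OF bv ab],
        of "(q - r) / 2" "- ((r + q) / 2)"] that
      unfolding E_def by simp
  qed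
  let ?N = "I \<union> (\<Union>r\<in>\<rat>. \<Union>q\<in>\<rat> \<inter> {r<..}. E r q)"
  have "negligible (\<Union>((\<lambda>(r, q). E r q) ` (SIGMA r:\<rat>. \<rat> \<inter> {r<..})))"
  proof (rule negligible_countable_Union)
    show "countable ((\<lambda>(r, q). E r q) ` (SIGMA r:\<rat>. \<rat> \<inter> {r<..}))"
      by (intro countable_image countable_SIGMA countable_rat countable_Int1)
  qed (auto intro: negE)
  moreover have "(\<Union>r\<in>\<rat>. \<Union>q\<in>\<rat> \<inter> {r<..}. E r q) = \<Union>((\<lambda>(r, q). E r q) ` (SIGMA r:\<rat>. \<rat> \<inter> {r<..}))"
    by auto
  moreover have "negligible I"
    unfolding I_def by (rule bounded_variation_infinite_slopes_negligible[OF ab bv])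
  ultimately have "negligible ?N" by (simp only: negligible_Un)
  moreover have "{x \<in> {a<..<b}. \<not> f field_differentiable (at x)} \<subseteq> ?N"
  proof (rule subsetI, rule ccontr)
    fix x assume x: "x \<in> {x \<in> {a<..<b}. \<not> f field_differentiable (at x)}" and nx: "x \<notin> ?N"
    have "x \<notin> I" "x \<in> {a<..<b}" using nx x by auto
    then have "\<exists>c>0. \<exists>\<delta>>0. \<forall>u v. \<not> (u \<le> x \<and> x \<le> v \<and> u < v \<and> v - u < \<delta> \<and> c * (v - u) \<le> \<bar>f v - f u\<bar>)"
      unfolding I_def by blast
    then obtain c \<delta> :: real where c: "c > 0" "\<delta> > 0"
      "\<And>u v. u \<le> x \<Longrightarrow> x \<le> v \<Longrightarrow> u < v \<Longrightarrow> v - u < \<delta> \<Longrightarrow> \<not> c * (v - u) \<le> \<bar>f v - f u\<bar>"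
      by metis
    obtain l where "((\<lambda>y. (f y - f x) / (y - x)) \<longlongrightarrow> l) (at x)"
    proof (rule tendsto_real_of_bounded[where F = "at x" and s = "\<lambda>y. (f y - f x) / (y - x)"])
      show "eventually (\<lambda>y. \<bar>(f y - f x) / (y - x)\<bar> \<le> c) (at x)"
      proof (rule eventually_difference_quotientI[OF c(2)])
        fix u v assume "u \<le> x" "x \<le> v" "u < v" "v - u < \<delta>"
        with c(3)[OF this] show "\<bar>(f v - f u) / (v - u)\<bar> \<le> c" by (simp add: abs_divide divide_le_eq)
      qed
    next
      fix r q :: real assume rq: "r \<in> \<rat>" "q \<in> \<rat>" "r < q"
      then have "x \<notin> E r q" using nx by auto
      with x obtain \<delta> where \<delta>: "\<delta> > 0"
        "(\<forall>u v. u \<le> x \<and> x \<le> v \<and> u < v \<and> v - u < \<delta> \<longrightarrow> \<not> q * (v - u) \<le> f v - f u) \<or>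
         (\<forall>u v. u \<le> x \<and> x \<le> v \<and> u < v \<and> v - u < \<delta> \<longrightarrow> \<not> f v - f u \<le> r * (v - u))"
        unfolding E_def by blast
      from \<delta>(2) show "eventually (\<lambda>y. (f y - f x) / (y - x) \<le> q) (at x) \<or>
        eventually (\<lambda>y. r \<le> (f y - f x) / (y - x)) (at x)"
      proof (elim disj_forward)
        assume *: "\<forall>u v. u \<le> x \<and> x \<le> v \<and> u < v \<and> v - u < \<delta> \<longrightarrow> \<not> q * (v - u) \<le> f v - f u"
        show "eventually (\<lambda>y. (f y - f x) / (y - x) \<le> q) (at x)"
        proof (rule eventually_difference_quotientI[OF \<delta>(1)])
          fix u v assume uv: "u \<le> x" "x \<le> v" "u < v" "v - u < \<delta>"
          with * have "\<not> q * (v - u) \<le> f v - f u" by blast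
          with uv show "(f v - f u) / (v - u) \<le> q" by (simp add: divide_le_eq)
        qed
      next
        assume *: "\<forall>u v. u \<le> x \<and> x \<le> v \<and> u < v \<and> v - u < \<delta> \<longrightarrow> \<not> f v - f u \<le> r * (v - u)"
        show "eventually (\<lambda>y. r \<le> (f y - f x) / (y - x)) (at x)"
        proof (rule eventually_difference_quotientI[OF \<delta>(1)])
          fix u v assume uv: "u \<le> x" "x \<le> v" "u < v" "v - u < \<delta>"
          with * have "\<not> f v - f u \<le> r * (v - u)" by blast
          with uv show "r \<le> (f v - f u) / (v - u)" by (simp add: le_divide_eq)
        qed
      qed
    qed simp
    then have "(f has_field_derivative l) (at x)" by (simp add: has_field_derivative_iff)
    then show False using x by (auto simp: field_differentiable_def)
  qed
  ultimately show ?thesis by (rule negligible_subset)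
qed

subsection \<open>Absolute continuity\<close>

lemma absolutely_continuous_fun_on_subset:
  "absolutely_continuous_fun_on I f \<Longrightarrow> J \<subseteq> I \<Longrightarrow> absolutely_continuous_fun_on J f"
  unfolding absolutely_continuous_fun_on_def by (meson order_trans)

text \<open>The definition numbers intervals by \<open>{..<n}\<close>, whereas tagged divisions are
  finite sets; a bijection transports the condition. The choice of \<open>d\<close> precedes that of
  the family.\<close>

lemma absolutely_continuous_fun_on_finite_family:
  assumes "absolutely_continuous_fun_on I f" "e > 0"
  shows "\<exists>d>0. \<forall>(S :: 'b set) l u. finite S \<longrightarrow> (\<forall>i\<in>S. l i \<le> u i \<and> {l i..u i} \<subseteq> I) \<longrightarrow>
       disjoint_family_on (\<lambda>i. {l i<..<u i}) S \<longrightarrow> (\<Sum>i\<in>S. u i - l i) < d \<longrightarrow>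
       (\<Sum>i\<in>S. \<bar>f (u i) - f (l i)\<bar>) < e"
proof -
  from assms obtain d where d: "d > 0"
    "\<And>(n::nat) (a::nat \<Rightarrow> real) b. (\<forall>i<n. a i \<le> b i \<and> {a i..b i} \<subseteq> I) \<Longrightarrow>
        disjoint_family_on (\<lambda>i. {a i<..<b i}) {..<n} \<Longrightarrow>
        (\<Sum>i<n. b i - a i) < d \<Longrightarrow> (\<Sum>i<n. \<bar>f (b i) - f (a i)\<bar>) < e"
    unfolding absolutely_continuous_fun_on_def by meson
  show ?thesis
  proof (intro exI[of _ d] conjI allI impI)
    fix S :: "'b set" and l u
    assume S: "finite S" and lu: "\<forall>i\<in>S. l i \<le> u i \<and> {l i..u i} \<subseteq> I"
      and disj: "disjoint_family_on (\<lambda>i. {l i<..<u i}) S" and sum: "(\<Sum>i\<in>S. u i - l i) < d"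
    from ex_bij_betw_nat_finite[OF S] obtain h where h: "bij_betw h {..<card S} S"
      by (auto simp: atLeast0LessThan)
    have hS: "h i \<in> S" if "i < card S" for i using h that by (auto simp: bij_betw_def)
    have "(\<Sum>i<card S. \<bar>f (u (h i)) - f (l (h i))\<bar>) < e"
    proof (rule d(2))
      show "\<forall>i<card S. l (h i) \<le> u (h i) \<and> {l (h i)..u (h i)} \<subseteq> I" using lu hS by auto
      show "disjoint_family_on (\<lambda>i. {l (h i)<..<u (h i)}) {..<card S}"
        unfolding disjoint_family_on_def
      proof (intro ballI impI)
        fix i j assume ij: "i \<in> {..<card S}" "j \<in> {..<card S}" "i \<noteq> j"
        then have "h i \<noteq> h j" using h by (auto simp: bij_betw_def inj_on_def)
        then show "{l (h i)<..<u (h i)} \<inter> {l (h j)<..<u (h j)} = {}"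
          using disj ij hS unfolding disjoint_family_on_def by blast
      qed
      show "(\<Sum>i<card S. u (h i) - l (h i)) < d"
        using sum sum.reindex_bij_betw[OF h, of "\<lambda>i. u i - l i"] by simp
    qed
    then show "(\<Sum>i\<in>S. \<bar>f (u i) - f (l i)\<bar>) < e"
      using sum.reindex_bij_betw[OF h, of "\<lambda>i. \<bar>f (u i) - f (l i)\<bar>"] by simp
  qed (rule d(1))
qed

lemma absolutely_continuous_fun_on_lipschitz_image:
  assumes f: "absolutely_continuous_fun_on I f"
    and lip: "\<And>x y. x \<in> I \<Longrightarrow> y \<in> I \<Longrightarrow> \<bar>g x - g y\<bar> \<le> C * \<bar>f x - f y\<bar>"
  shows "absolutely_continuous_fun_on I g"
  unfolding absolutely_continuous_fun_on_def
proof (intro allI impI)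
  fix e :: real assume "e > 0"
  \<comment> \<open>\<open>C\<close> may be zero or negative; the maximum makes e / ?C a legitimate
    tolerance.\<close>
  let ?C = "max C 1"
  from \<open>e > 0\<close> have "e / ?C > 0" by simp
  with f obtain d where d: "d > 0"
    "\<And>(n::nat) (a::nat \<Rightarrow> real) b. (\<forall>i<n. a i \<le> b i \<and> {a i..b i} \<subseteq> I) \<Longrightarrow>
        disjoint_family_on (\<lambda>i. {a i<..<b i}) {..<n} \<Longrightarrow>
        (\<Sum>i<n. b i - a i) < d \<Longrightarrow> (\<Sum>i<n. \<bar>f (b i) - f (a i)\<bar>) < e / ?C"
    unfolding absolutely_continuous_fun_on_def by meson
  show "\<exists>d>0. \<forall>(n::nat) (a::nat \<Rightarrow> real) b. (\<forall>i<n. a i \<le> b i \<and> {a i..b i} \<subseteq> I) \<longrightarrow>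
        disjoint_family_on (\<lambda>i. {a i<..<b i}) {..<n} \<longrightarrow>
        (\<Sum>i<n. b i - a i) < d \<longrightarrow> (\<Sum>i<n. \<bar>g (b i) - g (a i)\<bar>) < e"
  proof (intro exI[of _ d] conjI allI impI)
    fix n :: nat and a b :: "nat \<Rightarrow> real"
    assume *: "\<forall>i<n. a i \<le> b i \<and> {a i..b i} \<subseteq> I" "disjoint_family_on (\<lambda>i. {a i<..<b i}) {..<n}"
      "(\<Sum>i<n. b i - a i) < d"
    have "(\<Sum>i<n. \<bar>g (b i) - g (a i)\<bar>) \<le> (\<Sum>i<n. ?C * \<bar>f (b i) - f (a i)\<bar>)"
    proof (rule sum_mono)
      fix i assume "i \<in> {..<n}"
      then have "a i \<le> b i" "{a i..b i} \<subseteq> I" using *(1) by auto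
      then have "\<bar>g (b i) - g (a i)\<bar> \<le> C * \<bar>f (b i) - f (a i)\<bar>" by (intro lip) auto
      also have "\<dots> \<le> ?C * \<bar>f (b i) - f (a i)\<bar>" by (intro mult_right_mono) auto
      finally show "\<bar>g (b i) - g (a i)\<bar> \<le> ?C * \<bar>f (b i) - f (a i)\<bar>" .
    qed
    also have "\<dots> = ?C * (\<Sum>i<n. \<bar>f (b i) - f (a i)\<bar>)" by (rule sum_distrib_left[symmetric])
    also have "\<dots> < ?C * (e / ?C)" by (intro mult_strict_left_mono d(2) *) auto
    finally show "(\<Sum>i<n. \<bar>g (b i) - g (a i)\<bar>) < e" by simp
  qed (rule d(1))
qed

lemma absolutely_continuous_fun_on_lipschitz:
  assumes "\<And>x y. x \<in> I \<Longrightarrow> y \<in> I \<Longrightarrow> \<bar>g x - g y\<bar> \<le> C * \<bar>x - y\<bar>"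
  shows "absolutely_continuous_fun_on I g"
proof (rule absolutely_continuous_fun_on_lipschitz_image)
  show "absolutely_continuous_fun_on I (\<lambda>x. x)"
    unfolding absolutely_continuous_fun_on_def
  proof (intro allI impI)
    fix e :: real assume "e > 0"
    have "(\<Sum>i<n. \<bar>b i - a i\<bar>) = (\<Sum>i<n. b i - a i)" if "\<forall>i<n. a i \<le> b i \<and> {a i..b i} \<subseteq> I"
      for n and a b :: "nat \<Rightarrow> real"
      using that by (intro sum.cong) auto
    with \<open>e > 0\<close> show "\<exists>d>0. \<forall>(n::nat) (a::nat \<Rightarrow> real) b. (\<forall>i<n. a i \<le> b i \<and> {a i..b i} \<subseteq> I) \<longrightarrow>
        disjoint_family_on (\<lambda>i. {a i<..<b i}) {..<n} \<longrightarrow>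
        (\<Sum>i<n. b i - a i) < d \<longrightarrow> (\<Sum>i<n. \<bar>b i - a i\<bar>) < e"
      by (intro exI[of _ e]) simp
  qed
qed (rule assms)

text \<open>Clipping a sequence at \<open>c\<close> from above and from below gives one sequence for
  each side. A step across \<open>c\<close> is handled by the triangle inequality, every other step
  is constant on one side.\<close>

lemma bounded_variation_by_split:
  assumes "bounded_variation_by a c f M" "bounded_variation_by c b f M'" "a \<le> c" "c \<le> b"
  shows "bounded_variation_by a b f (M + M')"
  unfolding bounded_variation_by_def
proof safe
  fix n :: nat and p :: "nat \<Rightarrow> real"
  assume p: "mono p" "range p \<subseteq> {a..b}"
  have r: "p i \<in> {a..b}" for i using p(2) by blast
  let ?q = "\<lambda>i. min (p i) c" and ?r = "\<lambda>i. max (p i) c"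
  have mono: "mono ?q" "mono ?r"
    using p(1) by (auto simp: mono_def min_def max_def) (meson order_trans)+
  have range: "range ?q \<subseteq> {a..c}" "range ?r \<subseteq> {c..b}" using r assms(3,4) by auto
  have "(\<Sum>i<n. \<bar>f (p (Suc i)) - f (p i)\<bar>) \<le>
    (\<Sum>i<n. \<bar>f (?q (Suc i)) - f (?q i)\<bar> + \<bar>f (?r (Suc i)) - f (?r i)\<bar>)"
  proof (rule sum_mono)
    fix i
    have "p i \<le> p (Suc i)" using p(1) by (simp add: mono_def)
    then consider "p (Suc i) \<le> c" "p i \<le> c" | "p i \<le> c" "c \<le> p (Suc i)" | "c \<le> p i" "c \<le> p (Suc i)"
      by linarith
    then show "\<bar>f (p (Suc i)) - f (p i)\<bar> \<le> \<bar>f (?q (Suc i)) - f (?q i)\<bar> + \<bar>f (?r (Suc i)) - f (?r i)\<bar>"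
      by cases (simp_all add: min_absorb1 min_absorb2 max_absorb1 max_absorb2)
  qed
  also have "\<dots> = (\<Sum>i<n. \<bar>f (?q (Suc i)) - f (?q i)\<bar>) + (\<Sum>i<n. \<bar>f (?r (Suc i)) - f (?r i)\<bar>)"
    by (rule sum.distrib)
  also have "\<dots> \<le> M + M'"
    using assms(1,2) mono range unfolding bounded_variation_by_def by (intro add_mono) blast+
  finally show "(\<Sum>i<n. \<bar>f (p (Suc i)) - f (p i)\<bar>) \<le> M + M'" .
qed

text \<open>For tolerance 1 there is a \<open>d\<close> such that intervals shorter than
  \<open>d\<close> carry variation at most 1, and finitely many of them make up {a..b}.\<close>

lemma absolutely_continuous_imp_bounded_variation:
  assumes ac: "absolutely_continuous_fun_on {a..b} f" and ab: "a \<le> b"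
  obtains M where "bounded_variation_by a b f M"
proof -
  obtain d where d: "d > 0"
    "\<And>(n::nat) (l::nat \<Rightarrow> real) u. (\<forall>i<n. l i \<le> u i \<and> {l i..u i} \<subseteq> {a..b}) \<Longrightarrow>
        disjoint_family_on (\<lambda>i. {l i<..<u i}) {..<n} \<Longrightarrow>
        (\<Sum>i<n. u i - l i) < d \<Longrightarrow> (\<Sum>i<n. \<bar>f (u i) - f (l i)\<bar>) < 1"
    using ac[unfolded absolutely_continuous_fun_on_def, rule_format, OF zero_less_one] by meson
  have short: "bounded_variation_by s t f 1" if st: "a \<le> s" "t \<le> b" "t - s < d" for s t
    unfolding bounded_variation_by_def
  proof safe
    fix n :: nat and p :: "nat \<Rightarrow> real"
    assume p: "mono p" "range p \<subseteq> {s..t}"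
    have r: "p i \<in> {s..t}" for i using p(2) by blast
    have "(\<Sum>i<n. \<bar>f (p (Suc i)) - f (p i)\<bar>) < 1"
    proof (rule d(2))
      have "p i \<le> p (Suc i) \<and> {p i..p (Suc i)} \<subseteq> {a..b}" for i
        using r[of i] r[of "Suc i"] st p(1) by (auto simp: mono_def)
      then show "\<forall>i<n. p i \<le> p (Suc i) \<and> {p i..p (Suc i)} \<subseteq> {a..b}" by simp
      show "disjoint_family_on (\<lambda>i. {p i<..<p (Suc i)}) {..<n}"
        unfolding disjoint_family_on_def
      proof (intro ballI impI)
        fix i j :: nat assume "i \<noteq> j"
        then have "Suc i \<le> j \<or> Suc j \<le> i" by auto
        then have "p (Suc i) \<le> p j \<or> p (Suc j) \<le> p i" using p(1) by (auto dest: monoD)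
        then show "{p i<..<p (Suc i)} \<inter> {p j<..<p (Suc j)} = {}" by auto
      qed
      have "(\<Sum>i<n. p (Suc i) - p i) = p n - p 0" by (rule sum_lessThan_telescope)
      then show "(\<Sum>i<n. p (Suc i) - p i) < d" using r[of n] r[of 0] st by auto
    qed
    then show "(\<Sum>i<n. \<bar>f (p (Suc i)) - f (p i)\<bar>) \<le> 1" by simp
  qed
  \<comment> \<open>Pieces have length d / 2 because \<open>short\<close> requires length strictly
    below \<open>d\<close>; the induction peels off the last piece.\<close>
  have "bounded_variation_by a t f (real (Suc n))" if "a \<le> t" "t \<le> b" "t - a \<le> (real n + 1) * (d / 2)" for n t
    using that
  proof (induction n arbitrary: t)
    case 0
    then show ?case using short[of a t] d(1) by simp
  next
    case (Suc n)
    let ?c = "max a (t - d / 2)"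
    have "bounded_variation_by a ?c f (real (Suc n))"
      using Suc.prems d(1) by (intro Suc.IH) (auto simp: max_def algebra_simps)
    moreover have "bounded_variation_by ?c t f 1"
      using Suc.prems d(1) by (intro short) auto
    ultimately show ?case
      using bounded_variation_by_split[of a ?c f "real (Suc n)" t 1] Suc.prems d(1) by (simp add: add.commute)
  qed
  moreover obtain n where "(b - a) / (d / 2) \<le> real n" using real_arch_simple by blast
  then have "b - a \<le> (real n + 1) * (d / 2)" using d(1) by (simp add: field_simps)
  ultimately have "bounded_variation_by a b f (real (Suc n))" using ab by simp
  then show ?thesis by (rule that)
qed


subsection \<open>The fundamental theorem of calculus for absolutely continuous functions\<close>

lemma negligible_outer_open:
  assumes "negligible N" "e > 0"
  obtains T where "open T" "N \<subseteq> T" "T \<in> lmeasurable" "measure lebesgue T < e"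
proof -
  from negligible_imp_sets[OF assms(1)] assms(2) obtain T where
    T: "open T" "N \<subseteq> T" "T - N \<in> lmeasurable" "emeasure lebesgue (T - N) < ennreal e"
    by (rule sets_lebesgue_outer_open)
  have "emeasure lebesgue T = emeasure lebesgue (T - N)"
    using T(1) assms(1) by (intro emeasure_Diff_null_set[symmetric])
      (auto simp: negligible_iff_null_sets)
  then have "emeasure lebesgue T < ennreal e" using T(4) by simp
  moreover from this have "T \<in> lmeasurable"
    using T(1) by (intro fmeasurableI) (auto simp: less_top[symmetric] intro: order.strict_trans)
  ultimately show ?thesis
    using T(1,2) assms(2) by (intro that) (auto simp: emeasure_eq_measure2 ennreal_less_iff)
qed

text \<open>Subtract the first-order estimates at \<open>u\<close> and \<open>v\<close>: as
  \<open>x\<close> lies between them, the two errors are proportional to lengths that add up to v -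
  u.\<close>

lemma real_derivative_straddle:
  fixes f :: "real \<Rightarrow> real"
  assumes "(f has_real_derivative D) (at x within S)" "e > 0"
  obtains d where "d > 0"
    "\<And>u v. u \<in> S \<Longrightarrow> v \<in> S \<Longrightarrow> u \<le> x \<Longrightarrow> x \<le> v \<Longrightarrow> \<bar>u - x\<bar> < d \<Longrightarrow> \<bar>v - x\<bar> < d \<Longrightarrow>
       \<bar>(v - u) * D - (f v - f u)\<bar> \<le> e * (v - u)"
proof -
  from assms obtain d where d: "d > 0"
    "\<And>y. y \<in> S \<Longrightarrow> \<bar>y - x\<bar> < d \<Longrightarrow> \<bar>f y - f x - D * (y - x)\<bar> \<le> e * \<bar>y - x\<bar>"
    unfolding has_field_derivative_def has_derivative_within_alt by auto
  show ?thesis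
  proof (rule that[OF d(1)])
    fix u v assume *: "u \<in> S" "v \<in> S" "u \<le> x" "x \<le> v" "\<bar>u - x\<bar> < d" "\<bar>v - x\<bar> < d"
    have "(v - u) * D - (f v - f u) = (f u - f x - D * (u - x)) - (f v - f x - D * (v - x))"
      by (simp add: algebra_simps)
    also have "\<bar>\<dots>\<bar> \<le> e * \<bar>u - x\<bar> + e * \<bar>v - x\<bar>"
      using d(2)[of u] d(2)[of v] * by linarith
    also have "\<dots> = e * (v - u)" using * by (simp add: algebra_simps)
    finally show "\<bar>(v - u) * D - (f v - f u)\<bar> \<le> e * (v - u)" .
  qed
qed

text \<open>The tags in the exceptional set are forced into an open set of small measure, where absolute
  continuity bounds the increments.\<close>

theorem absolutely_continuous_has_integral:
  fixes f :: "real \<Rightarrow> real"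
  assumes ab: "a \<le> b" and ac: "absolutely_continuous_fun_on {a..b} f" and N: "negligible N"
    and deriv: "\<And>x. x \<in> {a..b} - N \<Longrightarrow> (f has_real_derivative f' x) (at x within {a..b})"
    and zero: "\<And>x. x \<in> N \<Longrightarrow> f' x = 0"
  shows "(f' has_integral f b - f a) {a..b}"
  unfolding has_integral_real
proof (intro allI impI)
  fix e :: real assume e: "e > 0"
  \<comment> \<open>Half of \<open>e\<close> is reserved for tags outside \<open>N\<close>, half for
    tags in \<open>N\<close>; the summand 1 avoids division by zero when a = b.\<close>
  define \<eta> where "\<eta> = e / (2 * (b - a + 1))"
  have \<eta>: "\<eta> > 0" "\<eta> * (b - a) < e / 2" using e ab by (auto simp: \<eta>_def field_simps)
  obtain \<delta> where \<delta>: "\<delta> > 0"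
    "\<forall>(S :: (real \<times> real set) set) l u. finite S \<longrightarrow> (\<forall>i\<in>S. l i \<le> u i \<and> {l i..u i} \<subseteq> {a..b}) \<longrightarrow>
       disjoint_family_on (\<lambda>i. {l i<..<u i}) S \<longrightarrow> (\<Sum>i\<in>S. u i - l i) < \<delta> \<longrightarrow>
       (\<Sum>i\<in>S. \<bar>f (u i) - f (l i)\<bar>) < e / 2"
    using absolutely_continuous_fun_on_finite_family[OF ac half_gt_zero[OF e], where ?'b = "real \<times> real set"]
    by (elim exE conjE) (rule that)
  obtain T where T: "open T" "N \<subseteq> T" "T \<in> lmeasurable" "measure lebesgue T < \<delta>"
    by (rule negligible_outer_open[OF N \<delta>(1)])
  have "\<exists>d>0. \<forall>u v. u \<in> {a..b} \<longrightarrow> v \<in> {a..b} \<longrightarrow> u \<le> x \<longrightarrow> x \<le> v \<longrightarrow> \<bar>u - x\<bar> < d \<longrightarrow> \<bar>v - x\<bar> < d \<longrightarrow>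
       \<bar>(v - u) * f' x - (f v - f u)\<bar> \<le> \<eta> * (v - u)" if "x \<in> {a..b} - N" for x
    by (rule real_derivative_straddle[OF deriv[OF that] \<eta>(1)]) meson
  then obtain d where d: "\<And>x. x \<in> {a..b} - N \<Longrightarrow> d x > 0"
    "\<And>x u v. x \<in> {a..b} - N \<Longrightarrow> u \<in> {a..b} \<Longrightarrow> v \<in> {a..b} \<Longrightarrow> u \<le> x \<Longrightarrow> x \<le> v \<Longrightarrow> \<bar>u - x\<bar> < d x \<Longrightarrow>
       \<bar>v - x\<bar> < d x \<Longrightarrow> \<bar>(v - u) * f' x - (f v - f u)\<bar> \<le> \<eta> * (v - u)"
    by metis
  \<comment> \<open>Tags in \<open>N\<close> confine their intervals to \<open>T\<close>, other tags
    to the range of the first-order estimate. Points outside {a..b} are never tags.\<close>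
  define \<gamma> where "\<gamma> x = (if x \<in> N then T else if x \<in> {a..b} then ball x (d x) else UNIV)" for x
  show "\<exists>\<gamma>. gauge \<gamma> \<and> (\<forall>p. p tagged_division_of {a..b} \<and> \<gamma> fine p \<longrightarrow>
     norm ((\<Sum>(x, K)\<in>p. measure lborel K *\<^sub>R f' x) - (f b - f a)) < e)"
  proof (intro exI[of _ \<gamma>] conjI allI impI)
    show "gauge \<gamma>" using T(1,2) d(1) by (auto simp: gauge_def \<gamma>_def)
    fix p assume "p tagged_division_of {a..b} \<and> \<gamma> fine p"
    then have p: "p tagged_division_of {a..b}" and fine: "\<gamma> fine p" by auto
    let ?l = "\<lambda>i :: real \<times> real set. Inf (snd i)" and ?u = "\<lambda>i :: real \<times> real set. Sup (snd i)"
    have fin: "finite p" using p by (rule tagged_division_of_finite)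
    have K: "{?l i..?u i} = snd i" "?l i \<le> ?u i" "fst i \<in> {?l i..?u i}" "{?l i..?u i} \<subseteq> {a..b}"
      "measure lborel (snd i) = ?u i - ?l i" if "i \<in> p" for i
    proof -
      obtain x K where i: "i = (x, K)" by (rule prod.exhaust)
      with p that have K: "x \<in> K" "K \<subseteq> {a..b}" "\<exists>c d. K = cbox c d"
        by (auto simp: tagged_division_of)
      then obtain c d where c: "K = {c..d}" by auto
      then have "c \<le> d" using K by auto
      then show "{?l i..?u i} = snd i" "?l i \<le> ?u i" "fst i \<in> {?l i..?u i}" "{?l i..?u i} \<subseteq> {a..b}"
        "measure lborel (snd i) = ?u i - ?l i"
        using K c by (simp_all add: i)
    qed
    have disj: "disjoint_family_on (\<lambda>i. {?l i<..<?u i}) p"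
      unfolding disjoint_family_on_def
    proof (intro ballI impI)
      fix i j assume ij: "i \<in> p" "j \<in> p" "i \<noteq> j"
      then have "interior (snd i) \<inter> interior (snd j) = {}"
        using p unfolding tagged_division_of by (metis prod.collapse)
      moreover have "{?l i<..<?u i} \<subseteq> interior (snd i)" if "i \<in> p" for i
        using greaterThanLessThan_subseteq_atLeastAtMost_iff[of "?l i" "?u i" "?l i" "?u i"]
        unfolding K(1)[OF that] by (intro interior_maximal) auto
      ultimately show "{?l i<..<?u i} \<inter> {?l j<..<?u j} = {}" using ij by blast
    qed
    let ?P = "{i \<in> p. fst i \<in> N}"
    let ?R = "{i \<in> p. fst i \<notin> N}"
    let ?h = "\<lambda>i :: real \<times> real set. measure lborel (snd i) * f' (fst i) - (f (?u i) - f (?l i))"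
    have len: "(\<Sum>i\<in>p. ?u i - ?l i) = b - a"
      using additive_tagged_division_1[OF ab p, of "\<lambda>x. x"] by (simp add: case_prod_beta)
    have disjP: "disjoint_family_on (\<lambda>i. {?l i<..<?u i}) ?P"
      by (rule disjoint_family_on_mono[OF _ disj]) auto
    \<comment> \<open>The intervals tagged in \<open>N\<close> have disjoint interiors inside
      \<open>T\<close>, so their total length is below \<delta>. As \<open>f'\<close> vanishes at
      these tags, their error is just the increment of \<open>f\<close>.\<close>
    have "(\<Sum>i\<in>?P. ?u i - ?l i) = (\<Sum>i\<in>?P. measure lebesgue {?l i<..<?u i})"
      by (rule sum.cong) (use K(2) in auto)
    also have "\<dots> = measure lebesgue (\<Union>i\<in>?P. {?l i<..<?u i})"
      using disjP fin by (intro measure_UNION'[symmetric])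
        (auto simp: pairwise_def disjnt_def disjoint_family_on_def)
    also have "\<dots> \<le> measure lebesgue T"
    proof (rule measure_mono_fmeasurable)
      show "(\<Union>i\<in>?P. {?l i<..<?u i}) \<subseteq> T"
      proof safe
        fix y x k assume *: "(x, k) \<in> p" "fst (x, k) \<in> N" "y \<in> {?l (x, k)<..<?u (x, k)}"
        then have "k \<subseteq> T" using fine unfolding fine_def \<gamma>_def by force
        have "y \<in> {?l (x, k)..?u (x, k)}" using *(3) by simp
        then have "y \<in> k" unfolding K(1)[OF *(1)] by simp
        then show "y \<in> T" using \<open>k \<subseteq> T\<close> by auto
      qed
      show "(\<Union>i\<in>?P. {?l i<..<?u i}) \<in> sets lebesgue"
        using fin by (intro sets.finite_UN) auto
    qed (rule T(3))
    finally have "(\<Sum>i\<in>?P. ?u i - ?l i) < \<delta>" using T(4) by simp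
    then have "(\<Sum>i\<in>?P. \<bar>f (?u i) - f (?l i)\<bar>) < e / 2"
      by (intro \<delta>(2)[rule_format] disjP) (use fin K in auto)
    moreover have "(\<Sum>i\<in>?P. \<bar>?h i\<bar>) = (\<Sum>i\<in>?P. \<bar>f (?u i) - f (?l i)\<bar>)"
      by (rule sum.cong) (use zero in auto)
    ultimately have P: "(\<Sum>i\<in>?P. \<bar>?h i\<bar>) < e / 2" by simp
    have "(\<Sum>i\<in>?R. \<bar>?h i\<bar>) \<le> (\<Sum>i\<in>?R. \<eta> * (?u i - ?l i))"
    proof (rule sum_mono)
      fix i assume i: "i \<in> ?R"
      then have ip: "i \<in> p" by auto
      have x: "fst i \<in> {a..b} - N" using i K(3,4)[OF ip] by auto
      have "snd i \<subseteq> \<gamma> (fst i)" using fine ip unfolding fine_def by force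
      then have "{?l i..?u i} \<subseteq> ball (fst i) (d (fst i))" unfolding K(1)[OF ip] using x by (simp add: \<gamma>_def)
      then have "?l i \<in> ball (fst i) (d (fst i))" "?u i \<in> ball (fst i) (d (fst i))"
        using K(2)[OF ip] by (meson atLeastAtMost_iff order_refl subsetD)+
      moreover have "?l i \<in> {a..b}" "?u i \<in> {a..b}" using K(2,4)[OF ip] by (meson atLeastAtMost_iff order_refl subsetD)+
      ultimately show "\<bar>?h i\<bar> \<le> \<eta> * (?u i - ?l i)"
        unfolding K(5)[OF ip]
        by (intro d(2)[OF x]) (use K(3)[OF ip] in \<open>auto simp: dist_real_def abs_minus_commute\<close>)
    qed
    also have "\<dots> \<le> (\<Sum>i\<in>p. \<eta> * (?u i - ?l i))"
      using fin K(2) \<eta>(1) by (intro sum_mono2) auto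
    also have "\<dots> = \<eta> * (\<Sum>i\<in>p. ?u i - ?l i)" by (rule sum_distrib_left[symmetric])
    also have "\<dots> < e / 2" using len \<eta>(2) by simp
    finally have R: "(\<Sum>i\<in>?R. \<bar>?h i\<bar>) < e / 2" .
    have "(\<Sum>(x, K)\<in>p. measure lborel K *\<^sub>R f' x) - (f b - f a) = (\<Sum>i\<in>p. ?h i)"
      using additive_tagged_division_1[OF ab p, of f] by (simp add: case_prod_beta sum_subtractf)
    also have "\<bar>\<dots>\<bar> \<le> (\<Sum>i\<in>p. \<bar>?h i\<bar>)" by (rule sum_abs)
    also have "\<dots> = (\<Sum>i\<in>?P. \<bar>?h i\<bar>) + (\<Sum>i\<in>?R. \<bar>?h i\<bar>)"
      using fin by (subst sum.union_disjoint[symmetric]) (auto intro!: sum.cong)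
    also have "\<dots> < e" using P R by simp
    finally show "norm ((\<Sum>(x, K)\<in>p. measure lborel K *\<^sub>R f' x) - (f b - f a)) < e" by simp
  qed
qed


subsection \<open>Energy of paths of variances\<close>

text \<open>Expanding the integral of \<open>(h - \<Delta>)\<^sup>2\<close> gives the bound and its equality case at once.\<close>

lemma
  fixes h :: "real \<Rightarrow> real"
  assumes h: "(h has_integral \<Delta>) {0..1}"
  shows square_integral_unit_interval_ge:
      "ennreal (\<Delta>\<^sup>2) \<le> (\<integral>\<^sup>+ t. ennreal ((h t)\<^sup>2) \<partial>lebesgue_on {0..1})" (is ?ge)
    and square_integral_unit_interval_minimal:
      "(\<integral>\<^sup>+ t. ennreal ((h t)\<^sup>2) \<partial>lebesgue_on {0..1}) \<le> ennreal (\<Delta>\<^sup>2) \<Longrightarrow>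
        AE t in lebesgue_on {0..1}. h t = \<Delta>" (is "?min \<Longrightarrow> ?const")
proof -
  let ?M = "lebesgue_on {0..1 :: real}" and ?I = "\<integral>\<^sup>+ t. ennreal ((h t)\<^sup>2) \<partial>lebesgue_on {0..1}"
  have "?ge \<and> (?min \<longrightarrow> ?const)"
  \<comment> \<open>An infinite integral makes the bound trivial and contradicts
    \<open>?min\<close>. Otherwise \<open>h\<close> is square integrable, which the expansion
    requires.\<close>
  proof (cases "?I = \<infinity>")
    case True
    then show ?thesis by (simp add: top_unique)
  next
    case False
    have [measurable]: "h \<in> borel_measurable ?M"
      using h by (intro integrable_imp_measurable) auto
    have fin: "finite_measure ?M"
      by (intro finite_measureI) (simp add: emeasure_restrict_space)
    then have const: "integrable ?M (\<lambda>_. c)" "integral\<^sup>L ?M (\<lambda>_. c) = c" for c :: real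
      by (simp_all add: finite_measure.integrable_const measure_restrict_space)
    have sq: "integrable ?M (\<lambda>t. (h t)\<^sup>2)"
      using False by (intro integrableI_nonneg) (auto simp: less_top)
    have int: "integrable ?M h"
    proof (rule Bochner_Integration.integrable_bound)
      show "integrable ?M (\<lambda>t. 1 + (h t)\<^sup>2)" using sq const by simp
      \<comment> \<open>On a space of finite measure this makes \<open>h\<close> integrable once its
        square is.\<close>
      have "\<bar>x\<bar> \<le> 1 + x\<^sup>2" for x :: real
        using zero_le_power2[of "\<bar>x\<bar> - 1"] by (simp add: power2_diff)
      then show "AE t in ?M. norm (h t) \<le> norm (1 + (h t)\<^sup>2)" by simp
    qed simp
    have "integral\<^sup>L ?M h = \<Delta>"
      using lebesgue_integral_eq_integral[OF int] h by (simp add: integral_unique)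
    moreover have dev: "integrable ?M (\<lambda>t. (h t - \<Delta>)\<^sup>2)"
      using sq int const unfolding power2_diff by simp
    ultimately have eq: "integral\<^sup>L ?M (\<lambda>t. (h t - \<Delta>)\<^sup>2) = integral\<^sup>L ?M (\<lambda>t. (h t)\<^sup>2) - \<Delta>\<^sup>2"
      using sq int const unfolding power2_diff by (simp add: power2_eq_square)
    have I: "?I = ennreal (integral\<^sup>L ?M (\<lambda>t. (h t)\<^sup>2))"
      by (rule nn_integral_eq_integral[OF sq]) simp
    have "0 \<le> integral\<^sup>L ?M (\<lambda>t. (h t - \<Delta>)\<^sup>2)" by simp
    then have ge: "\<Delta>\<^sup>2 \<le> integral\<^sup>L ?M (\<lambda>t. (h t)\<^sup>2)" using eq by simp
    moreover have ?const if ?min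
    proof -
      have "integral\<^sup>L ?M (\<lambda>t. (h t)\<^sup>2) \<le> \<Delta>\<^sup>2" using that unfolding I by (simp add: ennreal_le_iff)
      then have "integral\<^sup>L ?M (\<lambda>t. (h t - \<Delta>)\<^sup>2) = 0" using eq ge by simp
      then have "AE t in ?M. (h t - \<Delta>)\<^sup>2 = 0" by (subst (asm) integral_nonneg_eq_0_iff_AE[OF dev]) auto
      then show ?thesis by (elim AE_mp) simp
    qed
    ultimately show ?thesis unfolding I by (simp add: ennreal_leI)
  qed
  then show ?ge "?min \<Longrightarrow> ?const" by auto
qed

section \<open>The change of variable u = F (4 v / \<epsilon>)\<close>

context
  fixes \<epsilon> :: real and F :: "real \<Rightarrow> real"
  assumes eps: "\<epsilon> > 0"
    and F: "\<And>x. (F has_real_derivative (1 + x\<^sup>2) powr (- 1 / 4)) (at x)"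
begin

abbreviation (input) \<phi> :: "real \<Rightarrow> real" where "\<phi> v \<equiv> F (4 / \<epsilon> * v)"

lemma antiderivative_strict_mono: "x < y \<Longrightarrow> F x < F y"
proof (rule DERIV_pos_imp_increasing[where f = F])
  fix z :: real
  have "1 + z\<^sup>2 > 0" by (rule add_pos_nonneg) auto
  then have "(1 + z\<^sup>2) powr (- 1 / 4) > 0" by simp
  with F[of z] show "\<exists>D. DERIV F z :> D \<and> D > 0" by blast
qed

lemma antiderivative_le_iff: "F x \<le> F y \<longleftrightarrow> x \<le> y"
  by (metis antiderivative_strict_mono order_less_imp_le order_le_less not_less)

lemma inj_antiderivative: "inj F"
  by (rule injI) (metis antiderivative_le_iff order_antisym order_refl)

lemma powr_minus_quarter_sq: "((1 + x\<^sup>2) powr (- 1 / 4))\<^sup>2 = 1 / sqrt (1 + x\<^sup>2)" for x :: real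
proof -
  have "((1 + x\<^sup>2) powr (- 1 / 4))\<^sup>2 = (1 + x\<^sup>2) powr (- 1 / 2)"
    by (simp add: power2_eq_square flip: powr_add)
  also have "\<dots> = 1 / (1 + x\<^sup>2) powr (1 / 2)"
    using powr_minus_divide[of "1 + x\<^sup>2" "1 / 2"] by simp
  also have "\<dots> = 1 / sqrt (1 + x\<^sup>2)" by (simp add: powr_half_sqrt)
  finally show ?thesis .
qed

text \<open>Pulling (\<epsilon> / 4)^2 out of the root exhibits the metric coefficient as a squared
  derivative: since \<phi>' is 4 / \<epsilon> times F', it is \<epsilon> / 16 times the square of
  \<phi>'.\<close>

lemma sinkhorn_g_eq: "sinkhorn_g \<epsilon> v = ((1 + (4 / \<epsilon> * v)\<^sup>2) powr (- 1 / 4))\<^sup>2 / \<epsilon>"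
proof -
  have "\<epsilon>\<^sup>2 / 16 + v\<^sup>2 = (\<epsilon> / 4)\<^sup>2 * (1 + (4 / \<epsilon> * v)\<^sup>2)"
    using eps by (simp add: field_simps power2_eq_square)
  then have "sqrt (\<epsilon>\<^sup>2 / 16 + v\<^sup>2) = \<epsilon> / 4 * sqrt (1 + (4 / \<epsilon> * v)\<^sup>2)"
    using eps by (simp only: real_sqrt_mult real_sqrt_abs)
  then show ?thesis
    unfolding sinkhorn_g_def powr_minus_quarter_sq by (simp add: mult_ac)
qed

lemma antiderivative_lipschitz: "\<bar>F x - F y\<bar> \<le> \<bar>x - y\<bar>"
proof -
  have "\<bar>(1 + z\<^sup>2) powr (- 1 / 4)\<bar> \<le> 1" for z :: real
    using powr_mono2'[of "- 1 / 4" 1 "1 + z\<^sup>2"] by simp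
  then have "norm (F x - F y) \<le> 1 * norm (x - y)"
    by (intro field_differentiable_bound[OF convex_UNIV]) (use F in auto)
  then show ?thesis by simp
qed

lemma inv_antiderivative_has_derivative:
  "(inv F has_real_derivative (1 + z\<^sup>2) powr (1 / 4)) (at (F z))"
proof -
  have inv: "inv F (F x) = x" for x using inj_antiderivative by simp
  have cont: "continuous_on A F" for A
    by (intro continuous_at_imp_continuous_on ballI DERIV_isCont[OF F])
  have "1 + z\<^sup>2 > 0" by (rule add_pos_nonneg) auto
  have "(inv F has_real_derivative inverse ((1 + z\<^sup>2) powr (- 1 / 4))) (at (F z))"
  proof (rule DERIV_inverse_function[where f = F and a = "F (z - 1)" and b = "F (z + 1)"])
    show "(F has_real_derivative (1 + z\<^sup>2) powr (- 1 / 4)) (at (inv F (F z)))"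
      unfolding inv by (rule F)
    \<comment> \<open>Every value between \<open>F (z - 1)\<close> and \<open>F (z + 1)\<close> is
      attained, so near \<open>F z\<close> the function \<open>inv F\<close> is a true right
      inverse; the radius 1 is arbitrary.\<close>
    show "F (inv F y) = y" if y: "F (z - 1) < y" "y < F (z + 1)" for y
    proof -
      obtain x where "F x = y"
        using IVT'[of F "z - 1" y "z + 1"] cont y by fastforce
      then show ?thesis by (auto simp: inv)
    qed
    show "isCont (inv F) (F z)"
      by (rule isCont_inverse_function[where d = 1]) (use inv F in \<open>auto intro: DERIV_isCont\<close>)
  qed (use \<open>1 + z\<^sup>2 > 0\<close> in \<open>auto intro: antiderivative_strict_mono\<close>)
  then show ?thesis by (simp add: powr_minus)
qed

text \<open>Here \<open>h\<close> is the derivative of \<phi> along \<open>w\<close>, off a null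
  set. The integral identity is given for every \<open>t\<close>, not only t = 1, because recovering
  a minimizer needs its intermediate values.\<close>

lemma path_energy_eq_square_integral:
  assumes w: "absolutely_continuous_fun_on {0..1} w"
  obtains h where "\<And>t. t \<in> {0..1} \<Longrightarrow> (h has_integral \<phi> (w t) - \<phi> (w 0)) {0..t}"
    "path_energy \<epsilon> w = ennreal (\<epsilon> / 16) * (\<integral>\<^sup>+ t. ennreal ((h t)\<^sup>2) \<partial>lebesgue_on {0..1})"
proof -
  have ac: "absolutely_continuous_fun_on {0..1} (\<lambda>t. \<phi> (w t))"
  proof (rule absolutely_continuous_fun_on_lipschitz_image[OF w])
    fix x y
    have "\<bar>\<phi> (w x) - \<phi> (w y)\<bar> \<le> \<bar>4 / \<epsilon> * (w x - w y)\<bar>"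
      using antiderivative_lipschitz[of "4 / \<epsilon> * w x" "4 / \<epsilon> * w y"] by (simp add: right_diff_distrib)
    then show "\<bar>\<phi> (w x) - \<phi> (w y)\<bar> \<le> 4 / \<epsilon> * \<bar>w x - w y\<bar>"
      using eps by (simp only: abs_mult abs_divide)
  qed
  obtain M where M: "bounded_variation_by 0 1 w M"
    by (rule absolutely_continuous_imp_bounded_variation[OF w]) auto
  \<comment> \<open>The endpoints are included because \<open>deriv\<close> is two-sided and there
    depends on values of \<open>w\<close> outside the unit interval.\<close>
  define N where "N = {0, 1} \<union> {t \<in> {0<..<1}. \<not> w field_differentiable (at t)}"
  have N: "negligible N"
    unfolding N_def using bounded_variation_differentiable_ae[OF _ M] by simp
  define p where "p t = (1 + (4 / \<epsilon> * w t)\<^sup>2) powr (- 1 / 4)" for t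
  \<comment> \<open>The value 0 on \<open>N\<close> is what the integration theorem for absolutely
    continuous functions demands.\<close>
  define h where "h t = (if t \<in> N then 0 else p t * (4 / \<epsilon> * deriv w t))" for t
  have deriv: "((\<lambda>t. \<phi> (w t)) has_real_derivative h t) (at t)" if t: "t \<in> {0..1} - N" for t
  proof -
    have "w field_differentiable (at t)" using t by (auto simp: N_def)
    then have "(w has_real_derivative deriv w t) (at t)" by (simp add: DERIV_deriv_iff_field_differentiable)
    then have "((\<lambda>t. 4 / \<epsilon> * w t) has_real_derivative 4 / \<epsilon> * deriv w t) (at t)"
      by (rule DERIV_cmult)
    from DERIV_chain2[OF F this] show ?thesis using t by (simp add: h_def p_def)
  qed
  have "(h has_integral \<phi> (w t) - \<phi> (w 0)) {0..t}" if t: "t \<in> {0..1}" for t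
  proof (rule absolutely_continuous_has_integral[OF _ _ N])
    show "absolutely_continuous_fun_on {0..t} (\<lambda>t. \<phi> (w t))"
      by (rule absolutely_continuous_fun_on_subset[OF ac]) (use t in auto)
    show "((\<lambda>t. \<phi> (w t)) has_real_derivative h x) (at x within {0..t})" if "x \<in> {0..t} - N" for x
      by (rule has_field_derivative_at_within[OF deriv]) (use that t in auto)
  qed (use t in \<open>auto simp: h_def\<close>)
  moreover have "path_energy \<epsilon> w = ennreal (\<epsilon> / 16) * (\<integral>\<^sup>+ t. ennreal ((h t)\<^sup>2) \<partial>lebesgue_on {0..1})"
  proof -
    have [measurable]: "h \<in> borel_measurable (lebesgue_on {0..1})"
      using calculation[of 1] by (intro integrable_imp_measurable) auto
    have eq: "sinkhorn_g \<epsilon> (w t) * (deriv w t)\<^sup>2 = \<epsilon> / 16 * (h t)\<^sup>2" if "t \<notin> N" for t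
      using that eps by (simp add: sinkhorn_g_eq h_def p_def power_mult_distrib power_divide)
        (simp add: field_simps power2_eq_square)
    have "N \<in> null_sets lebesgue" using N by (simp add: negligible_iff_null_sets)
    then have "AE t in lebesgue. t \<notin> N" by (rule AE_not_in)
    then have ae: "AE t in lebesgue_on {0..1}. t \<notin> N" by (subst AE_restrict_space_iff) auto
    have "path_energy \<epsilon> w =
      (\<integral>\<^sup>+ t. ennreal (sinkhorn_g \<epsilon> (w t) * (deriv w t)\<^sup>2) \<partial>lebesgue_on {0..1})"
      unfolding path_energy_def by (subst nn_integral_restrict_space) auto
    also have "\<dots> = (\<integral>\<^sup>+ t. ennreal (\<epsilon> / 16) * ennreal ((h t)\<^sup>2) \<partial>lebesgue_on {0..1})"
      by (rule nn_integral_cong_AE, rule AE_mp[OF ae]) (use eps in \<open>simp add: eq flip: ennreal_mult\<close>)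
    also have "\<dots> = ennreal (\<epsilon> / 16) * (\<integral>\<^sup>+ t. ennreal ((h t)\<^sup>2) \<partial>lebesgue_on {0..1})"
      by (rule nn_integral_cmult) measurable
    finally show ?thesis .
  qed
  ultimately show ?thesis by (rule that)
qed

section \<open>The geodesic between two fixed variances\<close>

context
  fixes v\<^sub>0 v\<^sub>1 :: real
  assumes v: "v\<^sub>0 \<ge> 0" "v\<^sub>1 \<ge> 0"
begin

lemma path_energy_ge:
  assumes "w \<in> variance_paths v\<^sub>0 v\<^sub>1"
  shows "ennreal (\<epsilon> / 16 * (\<phi> v\<^sub>1 - \<phi> v\<^sub>0)\<^sup>2) \<le> path_energy \<epsilon> w"
proof -
  have w: "absolutely_continuous_fun_on {0..1} w" "w 0 = v\<^sub>0" "w 1 = v\<^sub>1"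
    using assms by (auto simp: variance_paths_def)
  obtain h where h: "\<And>t. t \<in> {0..1} \<Longrightarrow> (h has_integral \<phi> (w t) - \<phi> (w 0)) {0..t}"
    "path_energy \<epsilon> w = ennreal (\<epsilon> / 16) * (\<integral>\<^sup>+ t. ennreal ((h t)\<^sup>2) \<partial>lebesgue_on {0..1})"
    by (rule path_energy_eq_square_integral[OF w(1)]) blast
  have "(h has_integral \<phi> v\<^sub>1 - \<phi> v\<^sub>0) {0..1}" using h(1)[of 1] w by simp
  from square_integral_unit_interval_ge[OF this] show ?thesis
    unfolding h(2) by (subst ennreal_mult) (use eps in \<open>auto intro: mult_left_mono\<close>)
qed

text \<open>Equality in the square bound forces \<open>h\<close> to be constant almost everywhere,
  and integrating that constant over {0..t} recovers \<phi> of \<open>w t\<close>.\<close>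

lemma path_energy_minimal_imp_affine:
  assumes "w \<in> variance_paths v\<^sub>0 v\<^sub>1" and "path_energy \<epsilon> w \<le> ennreal (\<epsilon> / 16 * (\<phi> v\<^sub>1 - \<phi> v\<^sub>0)\<^sup>2)"
    and t: "t \<in> {0..1}"
  shows "\<phi> (w t) = (1 - t) * \<phi> v\<^sub>0 + t * \<phi> v\<^sub>1"
proof -
  let ?\<Delta> = "\<phi> v\<^sub>1 - \<phi> v\<^sub>0"
  have w: "absolutely_continuous_fun_on {0..1} w" "w 0 = v\<^sub>0" "w 1 = v\<^sub>1"
    using assms by (auto simp: variance_paths_def)
  obtain h where h: "\<And>t. t \<in> {0..1} \<Longrightarrow> (h has_integral \<phi> (w t) - \<phi> (w 0)) {0..t}"
    "path_energy \<epsilon> w = ennreal (\<epsilon> / 16) * (\<integral>\<^sup>+ t. ennreal ((h t)\<^sup>2) \<partial>lebesgue_on {0..1})"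
    by (rule path_energy_eq_square_integral[OF w(1)]) blast
  have "ennreal (\<epsilon> / 16) * (\<integral>\<^sup>+ t. ennreal ((h t)\<^sup>2) \<partial>lebesgue_on {0..1})
      \<le> ennreal (\<epsilon> / 16) * ennreal (?\<Delta>\<^sup>2)"
    using assms(2) unfolding h(2) by (subst (asm) ennreal_mult) (use eps in auto)
  then have "(\<integral>\<^sup>+ t. ennreal ((h t)\<^sup>2) \<partial>lebesgue_on {0..1}) \<le> ennreal (?\<Delta>\<^sup>2)"
    using eps by (subst (asm) ennreal_mult_le_mult_iff) auto
  moreover have "(h has_integral ?\<Delta>) {0..1}" using h(1)[of 1] w by simp
  ultimately have "AE s in lebesgue_on {0..1}. h s = ?\<Delta>"
    by (intro square_integral_unit_interval_minimal)
  then have "AE s in lebesgue. s \<in> {0..1} \<longrightarrow> h s = ?\<Delta>"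
    by (subst (asm) AE_restrict_space_iff) auto
  then have "AE s in lborel. s \<in> {0..t} \<longrightarrow> h s = ?\<Delta>"
    unfolding AE_completion_iff by (rule AE_mp) (use t in auto)
  from has_integral_AE[OF this] have "((\<lambda>_. ?\<Delta>) has_integral \<phi> (w t) - \<phi> (w 0)) {0..t}"
    using h(1)[OF t] by simp
  moreover have "((\<lambda>_. ?\<Delta>) has_integral t * ?\<Delta>) {0..t}"
    using has_integral_const_real[of ?\<Delta> 0 t] t by simp
  ultimately have "\<phi> (w t) - \<phi> (w 0) = t * ?\<Delta>" by (rule has_integral_unique)
  then show ?thesis using w by (simp add: algebra_simps)
qed

abbreviation (input) geodesic :: "real \<Rightarrow> real" where
  "geodesic t \<equiv> \<epsilon> / 4 * inv F ((1 - t) * \<phi> v\<^sub>0 + t * \<phi> v\<^sub>1)"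

abbreviation (input) geodesic_deriv :: "real \<Rightarrow> real" where
  "geodesic_deriv t \<equiv> \<epsilon> / 4 * (\<phi> v\<^sub>1 - \<phi> v\<^sub>0) * (1 + (4 / \<epsilon> * geodesic t)\<^sup>2) powr (1 / 4)"

text \<open>A convex combination of the two end values lies in the image under \<open>F\<close> of
  the segment between the rescaled variances, so \<open>inv F\<close> returns a point of that
  segment. Using \<open>min\<close> and \<open>max\<close> covers both orders of the
  endpoints.\<close>

lemma geodesic_between:
  assumes t: "t \<in> {0..1}"
  shows "\<phi> (geodesic t) = (1 - t) * \<phi> v\<^sub>0 + t * \<phi> v\<^sub>1"
    and "min v\<^sub>0 v\<^sub>1 \<le> geodesic t" and "geodesic t \<le> max v\<^sub>0 v\<^sub>1"
proof -
  let ?y = "(1 - t) * \<phi> v\<^sub>0 + t * \<phi> v\<^sub>1" and ?a = "4 / \<epsilon> * min v\<^sub>0 v\<^sub>1" and ?b = "4 / \<epsilon> * max v\<^sub>0 v\<^sub>1"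
  have le: "F ?a \<le> \<phi> u" "\<phi> u \<le> F ?b" if "u = v\<^sub>0 \<or> u = v\<^sub>1" for u
    using that eps unfolding antiderivative_le_iff by (auto simp: divide_right_mono)
  have "?y \<in> {F ?a..F ?b}"
    using convexD_alt[OF convex_real_interval(5), of "\<phi> v\<^sub>0" "F ?a" "F ?b" "\<phi> v\<^sub>1" t] le[of v\<^sub>0] le[of v\<^sub>1] t
    by simp
  moreover have "continuous_on {?a..?b} F"
    by (intro continuous_at_imp_continuous_on ballI DERIV_isCont[OF F])
  moreover have "?a \<le> ?b" using eps by (intro mult_left_mono) auto
  ultimately obtain z where z: "?a \<le> z" "z \<le> ?b" "F z = ?y"
    using IVT'[of F ?a ?y ?b] by auto
  have "geodesic t = \<epsilon> / 4 * z"
    unfolding z(3)[symmetric] using inj_antiderivative by simp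
  moreover have "min v\<^sub>0 v\<^sub>1 \<le> \<epsilon> / 4 * z" "\<epsilon> / 4 * z \<le> max v\<^sub>0 v\<^sub>1"
    using z(1,2) eps by (simp_all add: field_simps)
  moreover have "4 / \<epsilon> * (\<epsilon> / 4 * z) = z" using eps by simp
  ultimately show "\<phi> (geodesic t) = ?y" "min v\<^sub>0 v\<^sub>1 \<le> geodesic t" "geodesic t \<le> max v\<^sub>0 v\<^sub>1"
    using z(3) by (simp_all only:)
qed

lemma geodesic_nonneg: "t \<in> {0..1} \<Longrightarrow> 0 \<le> geodesic t"
  using geodesic_between(2)[of t] v by (simp add: min_le_iff_disj)

lemma geodesic_has_derivative:
  assumes t: "t \<in> {0..1}"
  shows "(geodesic has_real_derivative geodesic_deriv t) (at t)"
proof -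
  let ?L = "\<lambda>t. (1 - t) * \<phi> v\<^sub>0 + t * \<phi> v\<^sub>1"
  have "(?L has_real_derivative \<phi> v\<^sub>1 - \<phi> v\<^sub>0) (at t)"
    by (auto intro!: derivative_eq_intros)
  moreover have "(inv F has_real_derivative (1 + (4 / \<epsilon> * geodesic t)\<^sup>2) powr (1 / 4)) (at (?L t))"
    using inv_antiderivative_has_derivative[of "4 / \<epsilon> * geodesic t"] unfolding geodesic_between(1)[OF t] .
  ultimately have "((\<lambda>t. inv F (?L t)) has_real_derivative
      (1 + (4 / \<epsilon> * geodesic t)\<^sup>2) powr (1 / 4) * (\<phi> v\<^sub>1 - \<phi> v\<^sub>0)) (at t)"
    by (rule DERIV_chain2[rotated])
  from DERIV_cmult[OF this, of "\<epsilon> / 4"] show ?thesis by (simp add: mult_ac)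
qed

text \<open>The path stays in the bounded range between its end variances, where its derivative is
  bounded by \<open>?C\<close>; it is thus Lipschitz, hence absolutely continuous.\<close>

lemma geodesic_in_variance_paths: "geodesic \<in> variance_paths v\<^sub>0 v\<^sub>1"
proof -
  let ?C = "\<epsilon> / 4 * \<bar>\<phi> v\<^sub>1 - \<phi> v\<^sub>0\<bar> * (1 + (4 / \<epsilon> * max v\<^sub>0 v\<^sub>1)\<^sup>2) powr (1 / 4)"
  have bound: "norm (geodesic_deriv t) \<le> ?C" if t: "t \<in> {0..1}" for t
  proof -
    have "0 \<le> 4 / \<epsilon> * geodesic t" "4 / \<epsilon> * geodesic t \<le> 4 / \<epsilon> * max v\<^sub>0 v\<^sub>1"
      by (rule mult_nonneg_nonneg[OF _ geodesic_nonneg[OF t]] mult_left_mono[OF geodesic_between(3)[OF t]];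
        use eps in simp)+
    then have "(1 + (4 / \<epsilon> * geodesic t)\<^sup>2) powr (1 / 4) \<le> (1 + (4 / \<epsilon> * max v\<^sub>0 v\<^sub>1)\<^sup>2) powr (1 / 4)"
      by (intro powr_mono2 add_mono power_mono) auto
    moreover have "norm (geodesic_deriv t) =
        \<epsilon> / 4 * \<bar>\<phi> v\<^sub>1 - \<phi> v\<^sub>0\<bar> * (1 + (4 / \<epsilon> * geodesic t)\<^sup>2) powr (1 / 4)"
      using eps by (simp only: real_norm_def abs_mult) simp
    ultimately show ?thesis using eps by (simp only:) (intro mult_left_mono, auto)
  qed
  have "absolutely_continuous_fun_on {0..1} geodesic"
  proof (rule absolutely_continuous_fun_on_lipschitz)
    fix x y :: real assume xy: "x \<in> {0..1}" "y \<in> {0..1}"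
    have "norm (geodesic x - geodesic y) \<le> ?C * norm (x - y)"
      by (rule field_differentiable_bound[OF convex_real_interval(5) _ bound xy])
        (rule has_field_derivative_at_within[OF geodesic_has_derivative])
    then show "\<bar>geodesic x - geodesic y\<bar> \<le> ?C * \<bar>x - y\<bar>" by simp
  qed
  moreover have "geodesic 0 = v\<^sub>0" "geodesic 1 = v\<^sub>1"
    using inj_antiderivative eps by simp_all
  ultimately show ?thesis using geodesic_nonneg by (simp add: variance_paths_def)
qed

text \<open>The path has constant speed: the powers -1/4 from the metric and 1/4 from the derivative
  of \<open>inv F\<close> cancel. The derivative is two-sided even at 0 and 1, so the integrand is
  constant at every point of {0..1}.\<close>

lemma path_energy_geodesic: "path_energy \<epsilon> geodesic = ennreal (\<epsilon> / 16 * (\<phi> v\<^sub>1 - \<phi> v\<^sub>0)\<^sup>2)"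
proof -
  have eq: "sinkhorn_g \<epsilon> (geodesic t) * (deriv geodesic t)\<^sup>2 = \<epsilon> / 16 * (\<phi> v\<^sub>1 - \<phi> v\<^sub>0)\<^sup>2"
    if t: "t \<in> {0..1}" for t
  proof -
    let ?x = "4 / \<epsilon> * geodesic t"
    have pos: "1 + ?x\<^sup>2 > 0" by (rule add_pos_nonneg) auto
    have "(1 + ?x\<^sup>2) powr (- 1 / 4) * (1 + ?x\<^sup>2) powr (1 / 4) = (1 + ?x\<^sup>2) powr (- 1 / 4 + 1 / 4)"
      by (rule powr_add[symmetric])
    also have "\<dots> = 1" using pos by simp
    finally have one: "(1 + ?x\<^sup>2) powr (- 1 / 4) * (1 + ?x\<^sup>2) powr (1 / 4) = 1" .
    have "sinkhorn_g \<epsilon> (geodesic t) * (deriv geodesic t)\<^sup>2 =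
      ((1 + ?x\<^sup>2) powr (- 1 / 4))\<^sup>2 / \<epsilon> * (\<epsilon> / 4 * (\<phi> v\<^sub>1 - \<phi> v\<^sub>0) * (1 + ?x\<^sup>2) powr (1 / 4))\<^sup>2"
      by (simp only: sinkhorn_g_eq DERIV_imp_deriv[OF geodesic_has_derivative[OF t]])
    also have "\<dots> = ((1 + ?x\<^sup>2) powr (- 1 / 4) * (1 + ?x\<^sup>2) powr (1 / 4))\<^sup>2
       * (\<epsilon>\<^sup>2 / \<epsilon> / 16 * (\<phi> v\<^sub>1 - \<phi> v\<^sub>0)\<^sup>2)"
      by (simp add: power_mult_distrib power_divide mult_ac)
    also have "\<dots> = \<epsilon> / 16 * (\<phi> v\<^sub>1 - \<phi> v\<^sub>0)\<^sup>2"
      unfolding one using eps by (simp add: power2_eq_square)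
    finally show ?thesis .
  qed
  have "path_energy \<epsilon> geodesic =
      (\<integral>\<^sup>+ t. ennreal (\<epsilon> / 16 * (\<phi> v\<^sub>1 - \<phi> v\<^sub>0)\<^sup>2) * indicator {0..1::real} t \<partial>lebesgue)"
    unfolding path_energy_def
  proof (rule nn_integral_cong)
    fix t
    show "ennreal (sinkhorn_g \<epsilon> (geodesic t) * (deriv geodesic t)\<^sup>2) * indicator {0..1} t =
        ennreal (\<epsilon> / 16 * (\<phi> v\<^sub>1 - \<phi> v\<^sub>0)\<^sup>2) * indicator {0..1} t"
      by (cases "t \<in> {0..1}") (simp_all only: eq indicator_simps mult_zero_right simp_thms)
  qed
  also have "\<dots> = ennreal (\<epsilon> / 16 * (\<phi> v\<^sub>1 - \<phi> v\<^sub>0)\<^sup>2)"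
    by (subst nn_integral_cmult_indicator) auto
  finally show ?thesis .
qed

text \<open>The sign of \<open>?\<Delta>\<close> decides whether the path rises or falls. The power
  factor \<open>?q\<close> follows the same direction because variances are nonnegative, so its
  product with \<open>?\<Delta>\<close> increases in both cases.\<close>

lemma convex_on_geodesic: "convex_on {0..1} geodesic"
proof (rule convex_on_realI[OF _ geodesic_has_derivative])
  fix s t :: real assume st: "s \<in> {0..1}" "t \<in> {0..1}" "s \<le> t"
  let ?\<Delta> = "\<phi> v\<^sub>1 - \<phi> v\<^sub>0" and ?q = "\<lambda>t. (1 + (4 / \<epsilon> * geodesic t)\<^sup>2) powr (1 / 4)"
  have mono: "?q x \<le> ?q y" if "x \<in> {0..1}" "y \<in> {0..1}" "\<phi> (geodesic x) \<le> \<phi> (geodesic y)" for x y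
  proof -
    have "4 / \<epsilon> * geodesic x \<le> 4 / \<epsilon> * geodesic y"
      using that(3) unfolding antiderivative_le_iff .
    moreover have "0 \<le> 4 / \<epsilon> * geodesic x"
      by (rule mult_nonneg_nonneg[OF _ geodesic_nonneg[OF that(1)]]) (use eps in simp)
    ultimately show ?thesis by (intro powr_mono2 add_mono power_mono) auto
  qed
  have eq: "\<phi> (geodesic x) = \<phi> v\<^sub>0 + x * ?\<Delta>" if "x \<in> {0..1}" for x
    using geodesic_between(1)[OF that] by (simp add: algebra_simps)
  have "?\<Delta> * ?q s \<le> ?\<Delta> * ?q t"
  proof (cases "?\<Delta> \<ge> 0")
    case True
    then have "\<phi> (geodesic s) \<le> \<phi> (geodesic t)"
      unfolding eq[OF st(1)] eq[OF st(2)] using st(3) by (simp add: mult_right_mono)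
    with True mono[OF st(1,2)] show ?thesis by (intro mult_left_mono)
  next
    case False
    then have "\<phi> (geodesic t) \<le> \<phi> (geodesic s)"
      unfolding eq[OF st(1)] eq[OF st(2)] using st(3) by (simp add: mult_right_mono_neg)
    with False mono[OF st(2,1)] show ?thesis by (intro mult_left_mono_neg) auto
  qed
  then have "\<epsilon> / 4 * (?\<Delta> * ?q s) \<le> \<epsilon> / 4 * (?\<Delta> * ?q t)"
    by (rule mult_left_mono) (use eps in simp)
  then show "geodesic_deriv s \<le> geodesic_deriv t" by (simp only: mult.assoc)
qed auto

lemma sinkhorn_geodesic_dist_eq:
  "sinkhorn_geodesic_dist \<epsilon> v\<^sub>0 v\<^sub>1 = ennreal (sqrt \<epsilon> / 4 * \<bar>\<phi> v\<^sub>1 - \<phi> v\<^sub>0\<bar>)"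
proof -
  have "(INF w \<in> variance_paths v\<^sub>0 v\<^sub>1. path_energy \<epsilon> w) = ennreal (\<epsilon> / 16 * (\<phi> v\<^sub>1 - \<phi> v\<^sub>0)\<^sup>2)"
  proof (rule antisym)
    show "(INF w \<in> variance_paths v\<^sub>0 v\<^sub>1. path_energy \<epsilon> w) \<le> ennreal (\<epsilon> / 16 * (\<phi> v\<^sub>1 - \<phi> v\<^sub>0)\<^sup>2)"
      by (rule INF_lower2[OF geodesic_in_variance_paths]) (simp only: path_energy_geodesic order_refl)
  qed (intro INF_greatest path_energy_ge)
  moreover have "sqrt (\<epsilon> / 16 * (\<phi> v\<^sub>1 - \<phi> v\<^sub>0)\<^sup>2) = sqrt \<epsilon> / 4 * \<bar>\<phi> v\<^sub>1 - \<phi> v\<^sub>0\<bar>"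
  proof -
    have "sqrt 16 = (4 :: real)" using real_sqrt_abs[of 4] by simp
    then show ?thesis by (simp only: real_sqrt_mult real_sqrt_divide real_sqrt_abs)
  qed
  ultimately show ?thesis
    using eps by (simp add: sinkhorn_geodesic_dist_def ennreal_sqrt_def)
qed

lemma is_sinkhorn_geodesic_geodesic: "is_sinkhorn_geodesic \<epsilon> v\<^sub>0 v\<^sub>1 geodesic"
  unfolding is_sinkhorn_geodesic_def path_energy_geodesic
  using geodesic_in_variance_paths path_energy_ge by blast

text \<open>Any minimizer is affine in the coordinate \<phi>, and injectivity of \<open>F\<close>
  transfers this back to variances. Agreement is claimed on {0..1} only, since a minimizer may be
  altered arbitrarily outside.\<close>

lemma is_sinkhorn_geodesic_unique:
  assumes w: "is_sinkhorn_geodesic \<epsilon> v\<^sub>0 v\<^sub>1 w" and t: "t \<in> {0..1}"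
  shows "w t = geodesic t"
proof -
  have "w \<in> variance_paths v\<^sub>0 v\<^sub>1" using w unfolding is_sinkhorn_geodesic_def by blast
  moreover have "path_energy \<epsilon> w \<le> path_energy \<epsilon> geodesic"
    using w geodesic_in_variance_paths unfolding is_sinkhorn_geodesic_def by blast
  ultimately have "\<phi> (w t) = \<phi> (geodesic t)"
    unfolding path_energy_geodesic geodesic_between(1)[OF t]
    by (rule path_energy_minimal_imp_affine[OF _ _ t])
  then have "4 / \<epsilon> * w t = 4 / \<epsilon> * geodesic t" by (rule injD[OF inj_antiderivative])
  then show ?thesis using eps by (subst (asm) mult_left_cancel) auto
qed

end

end

theorem theorem6p2:
  fixes \<epsilon> v\<^sub>0 v\<^sub>1 :: real and F :: "real \<Rightarrow> real"
  assumes "\<epsilon> > 0"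
    and "\<And>x. (F has_real_derivative (1 + x\<^sup>2) powr (- 1 / 4)) (at x)"
    and "v\<^sub>0 \<ge> 0" and "v\<^sub>1 \<ge> 0"
  shows "sinkhorn_geodesic_dist \<epsilon> v\<^sub>0 v\<^sub>1 =
           ennreal (sqrt \<epsilon> / 4 * \<bar>F (4 / \<epsilon> * v\<^sub>1) - F (4 / \<epsilon> * v\<^sub>0)\<bar>) \<and>
         (let v = (\<lambda>t. \<epsilon> / 4 * inv F ((1 - t) * F (4 / \<epsilon> * v\<^sub>0) + t * F (4 / \<epsilon> * v\<^sub>1))) in
            is_sinkhorn_geodesic \<epsilon> v\<^sub>0 v\<^sub>1 v \<and>
            (\<forall>w. is_sinkhorn_geodesic \<epsilon> v\<^sub>0 v\<^sub>1 w \<longrightarrow> (\<forall>t\<in>{0..1}. w t = v t)) \<and>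
            convex_on {0..1} v)"
  unfolding Let_def
  using sinkhorn_geodesic_dist_eq[OF assms] is_sinkhorn_geodesic_geodesic[OF assms]
    is_sinkhorn_geodesic_unique[OF assms] convex_on_geodesic[OF assms]
  by blast

end
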